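(* In a game with incomplete information as described in the context, suppose Assumptions (P'), (I) and (RD) hold. Then every mixed strategy profile $g$ with each $g_i$ $\mathcal F_i$-measurable has an undistinguishable purification $f$ with each $f_i$ $\mathcal T_i$-measurable; that is, $f$ is a pure strategy profile such that $f$ and $g$ are universally distribution equivalent, universally payoff equivalent, and $f$ is belief consistent with $g$.
   Context: Game with incomplete information: players $I=\{1,\dots,n\}$. Each player $i$ has an action space $A_i$, a compact metric space; $A=\prod_{i\in I}A_i$ with Borel $\sigma$-algebra $\mathcal B(A)$. Each player $i$ has an information space $(T_i,\mathcal T_i,\lambda_i)$, an atomless probability space with $\lambda_i$ complete and countably additive; $T=\prod_i T_i$, $\mathcal T=\bigotimes_i\mathcal T_i$, and $\lambda$ is a probability measure on $(T,\mathcal T)$ whose marginal on $T_i$ is $\lambda_i$. For each $i$, $\mathcal F_i\subseteq\mathcal T_i$ is a sub-$\sigma$-algebra. Player $i$ has a payoff function $u_i:A\times T_i\to\mathbb R$. $\mathcal M(A_i)$ denotes the space of Borel probability measures on $A_i$ with the topology of weak convergence. A mixed strategy of $i$ is a measurable map $f_i:T_i\to\mathcal M(A_i)$ (write $f_i(t_i,\cdot)$ for the measure); a pure strategy is a measurable map $f_i:T_i\to A_i$, identified with $t_i\mapsto\delta_{f_i(t_i)}$. For a strategy profile $f=(f_1,\dots,f_n)$ and $E\in\mathcal T_i$, $U_i^E(f)=\int_{E\times\prod_{j\ne i}T_j}\int_A u_i(a_1,\dots,a_n,t_i)\prod_{j\in I}f_j(t_j,\mathrm d a_j)\,\mathrm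 d\lambda(t)$. Assumption (I): $\lambda=\bigotimes_{i\in I}\lambda_i$. Assumption (P'): for each $i$, $\mathcal F_i$ is countably generated; $u_i$ is $\mathcal B(A)\otimes\mathcal F_i$-measurable; $u_i(\cdot,t_i)$ is continuous on $A$ for every $t_i$; and there is a real-valued function $h_i$ integrable on $(T_i,\mathcal F_i,\lambda_i)$ with $|u_i|\le h_i$ on $A\times T_i$. Nowhere equivalence: $\mathcal T_i$ is nowhere equivalent to $\mathcal F_i$ if for every $D\in\mathcal T_i$ with $\lambda_i(D)>0$ there is a $\mathcal T_i$-measurable $D_0\subseteq D$ such that $\lambda_i(D_0\triangle D_1)>0$ for every $D_1\in\{D\cap D':D'\in\mathcal F_i\}$. Assumption (RD): for each $i$, $\mathcal T_i$ is atomless and nowhere equivalent to $\mathcal F_i$. Universal distribution equivalence: for every $i$ and every $E\in\mathcal F_i$, $\int_E f_i(t_i,\cdot)\,\mathrm d\lambda_i=\int_E g_i(t_i,\cdot)\,\mathrm d\lambda_i$ as measures on $A_i$. Universal payoff equivalence: $U_i^E(f)=U_i^E(g)$ for every $i$ and every $E\in\mathcal F_i$. Belief consistency (for pure $f$): for every $i$, $f_i(t_i)\in\operatorname{supp}g_i(t_i)$ for $\lambda_i$-almost all $t_i$. *)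

theory Defs
  imports "HOL-Probability.Probability"
begin

text \<open>Players form a finite type 'i. Action spaces are compact subsets Act i of a
  common metric space type 'a, with their Borel sigma-algebra. Information spaces
  are measures M i on a common type 't. The sub-sigma-algebra F_i is a measure F i
  with subalgebra (M i) (F i).\<close>

definition act_space :: "'a::metric_space set \<Rightarrow> 'a measure" where
  "act_space S = restrict_space borel S"

definition atomless :: "'t measure \<Rightarrow> bool" where
  "atomless M \<longleftrightarrow> (\<forall>A\<in>sets M. 0 < emeasure M A \<longrightarrow>
      (\<exists>B\<in>sets M. B \<subseteq> A \<and> 0 < emeasure M B \<and> emeasure M B < emeasure M A))"

definition countably_generated :: "'t measure \<Rightarrow> bool" where
  "countably_generated F \<longleftrightarrow> (\<exists>G. countable G \<and> G \<subseteq> Pow (space F) \<and>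
      sets F = sigma_sets (space F) G)"

definition nowhere_equivalent :: "'t measure \<Rightarrow> 't measure \<Rightarrow> bool" where
  "nowhere_equivalent M F \<longleftrightarrow> (\<forall>D\<in>sets M. 0 < measure M D \<longrightarrow>
      (\<exists>D0\<in>sets M. D0 \<subseteq> D \<and>
         (\<forall>D'\<in>sets F. 0 < measure M ((D0 - (D \<inter> D')) \<union> ((D \<inter> D') - D0)))))"

definition supp :: "'a::metric_space set \<Rightarrow> 'a measure \<Rightarrow> 'a set" where
  "supp S \<mu> = {x\<in>S. \<forall>U. open U \<longrightarrow> x \<in> U \<longrightarrow> 0 < measure \<mu> (U \<inter> S)}"

definition pure_to_mixed :: "('i \<Rightarrow> 'a::metric_space set) \<Rightarrow> ('i \<Rightarrow> 't \<Rightarrow> 'a) \<Rightarrow> 'i \<Rightarrow> 't \<Rightarrow> 'a measure" where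
  "pure_to_mixed Act f i t = return (act_space (Act i)) (f i t)"

text \<open>Payoff U_i^E(f) for a mixed profile f; lambda is the product measure (Assumption (I)).\<close>
definition payoff :: "('i::finite \<Rightarrow> 't measure) \<Rightarrow> ('i \<Rightarrow> ('i \<Rightarrow> 'a) \<Rightarrow> 't \<Rightarrow> real)
    \<Rightarrow> ('i \<Rightarrow> 't \<Rightarrow> 'a measure) \<Rightarrow> 'i \<Rightarrow> 't set \<Rightarrow> real" where
  "payoff M u f i E =
     (\<integral>t. indicator E (t i) * (\<integral>a. u i a (t i) \<partial>(PiM UNIV (\<lambda>j. f j (t j)))) \<partial>(PiM UNIV M))"

definition univ_dist_equiv :: "('i \<Rightarrow> 'a::metric_space set) \<Rightarrow> ('i \<Rightarrow> 't measure) \<Rightarrow> ('i \<Rightarrow> 't measure)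
    \<Rightarrow> ('i \<Rightarrow> 't \<Rightarrow> 'a measure) \<Rightarrow> ('i \<Rightarrow> 't \<Rightarrow> 'a measure) \<Rightarrow> bool" where
  "univ_dist_equiv Act M F f g \<longleftrightarrow> (\<forall>i. \<forall>E\<in>sets (F i). \<forall>B\<in>sets (act_space (Act i)).
      (\<integral>t. indicator E t * measure (f i t) B \<partial>(M i)) = (\<integral>t. indicator E t * measure (g i t) B \<partial>(M i)))"

definition univ_payoff_equiv :: "('i::finite \<Rightarrow> 't measure) \<Rightarrow> ('i \<Rightarrow> 't measure)
    \<Rightarrow> ('i \<Rightarrow> ('i \<Rightarrow> 'a) \<Rightarrow> 't \<Rightarrow> real)
    \<Rightarrow> ('i \<Rightarrow> 't \<Rightarrow> 'a measure) \<Rightarrow> ('i \<Rightarrow> 't \<Rightarrow> 'a measure) \<Rightarrow> bool" where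
  "univ_payoff_equiv M F u f g \<longleftrightarrow> (\<forall>i. \<forall>E\<in>sets (F i). payoff M u f i E = payoff M u g i E)"

definition belief_consistent :: "('i \<Rightarrow> 'a::metric_space set) \<Rightarrow> ('i \<Rightarrow> 't measure)
    \<Rightarrow> ('i \<Rightarrow> 't \<Rightarrow> 'a) \<Rightarrow> ('i \<Rightarrow> 't \<Rightarrow> 'a measure) \<Rightarrow> bool" where
  "belief_consistent Act M f g \<longleftrightarrow> (\<forall>i. AE t in M i. f i t \<in> supp (Act i) (g i t))"

end

(*
  Nowhere equivalence says that M is atomless conditionally on F, so that an exhaustion argument
  yields a Maharam-type lemma: every F-measurable function between 0 and P(D|F) is the conditional
  probability of some subset of D.  Splitting sets along the binary tree produces, for any
  F-measurable kernel on the Cantor space, a map whose conditional law given F is that kernel.  A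
  compact metric space is a Borel retract of the Cantor space, so the same holds for kernels on the
  action spaces.  Being in the support is then a matter of countably many null sets.  By independence
  the joint law of the action profile and the type of one player is determined by the measures
  obtained from the strategies by integrating over sets in F, and payoffs are integrals against this
  joint law.
*)
theory Submission
  imports Defs
begin

text \<open>Atomlessness alone yields subsets of \<open>D\<close> of prescribed measure; here a
  whole \<open>F\<close>-measurable function of conditional probabilities has to be matched at once.
  Nowhere equivalence is only qualitative: it gives a \<open>D0\<close> that no set in
  \<open>F\<close> cuts out of \<open>D\<close>. The quantitative gain comes from comparing
  \<open>D0\<close> with \<open>D - D0\<close> conditionally and keeping, on separate sets in
  \<open>F\<close>, the smaller of the two where it does not vanish. Cantor space is the
  intermediate target because each node of the binary tree asks for a single split into two sets,
  and the resulting nested sets determine a point map directly. What is passed from one stage to the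
  next are integrals over sets in \<open>F\<close>: they do not depend on versions of conditional
  probabilities, they can be compared on a pi-system, and they multiply across independent
  players.\<close>

context finite_measure_subalgebra
begin

section \<open>Conditional probabilities of sets given \<open>F\<close>\<close>

abbreviation cond_prob :: "'a set \<Rightarrow> 'a \<Rightarrow> real" where
  "cond_prob D \<equiv> real_cond_exp M F (indicator D)"

lemma space_F: "space F = space M"
  using subalg by (simp add: subalgebra_def)

lemma sets_F_imp_sets: "E \<in> sets F \<Longrightarrow> E \<in> sets M"
  using subalg by (auto simp: subalgebra_def)

lemma integrable_cond_prob: "D \<in> sets M \<Longrightarrow> integrable M (cond_prob D)"
  by (intro real_cond_exp_int(1)) (simp add: less_top[symmetric])

lemma cond_prob_integral:
  assumes "D \<in> sets M" "E \<in> sets F"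
  shows "(\<integral>x. indicator E x * cond_prob D x \<partial>M) = measure M (E \<inter> D)"
proof -
  have "(\<integral>x. indicator E x * cond_prob D x \<partial>M) = (\<integral>x. indicator E x * indicator D x \<partial>M)"
    using real_cond_exp_intA[of "indicator D :: 'a \<Rightarrow> real" E] assms
    by (auto simp: set_lebesgue_integral_def less_top[symmetric])
  also have "\<dots> = (\<integral>x. indicator (E \<inter> D) x \<partial>M)"
    by (simp add: indicator_inter_arith)
  also have "\<dots> = measure M (E \<inter> D)"
    using assms sets_F_imp_sets[of E] by (simp add: Int_absorb1 sets.sets_into_space le_infI2)
  finally show ?thesis .
qed

lemma integrable_indicator_mult:
  fixes f :: "'a \<Rightarrow> real"
  shows "E \<in> sets F \<Longrightarrow> integrable M f \<Longrightarrow> integrable M (\<lambda>x. indicator E x * f x)"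
  using integrable_mult_indicator[of E M f] sets_F_imp_sets[of E] by simp

lemma cond_prob_nonneg: "D \<in> sets M \<Longrightarrow> AE x in M. 0 \<le> cond_prob D x"
  by (intro real_cond_exp_pos) auto

lemma cond_prob_mono:
  "C \<in> sets M \<Longrightarrow> D \<in> sets M \<Longrightarrow> C \<subseteq> D \<Longrightarrow> AE x in M. cond_prob C x \<le> cond_prob D x"
  by (intro real_cond_exp_mono AE_I2) (auto simp: indicator_def less_top[symmetric])

lemma cond_prob_le_1:
  assumes "D \<in> sets M" shows "AE x in M. cond_prob D x \<le> 1"
  using assms by (intro real_cond_exp_le_c) (auto simp: less_top[symmetric] indicator_le_1)

lemma cond_prob_Diff:
  assumes "C \<in> sets M" "D \<in> sets M" "C \<subseteq> D"
  shows "AE x in M. cond_prob (D - C) x = cond_prob D x - cond_prob C x"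
proof -
  have "(indicator (D - C) :: 'a \<Rightarrow> real) = (\<lambda>x. indicator D x - indicator C x)"
    using assms(3) by (auto simp: indicator_def fun_eq_iff)
  then show ?thesis
    using assms by (simp add: less_top[symmetric])
qed

lemma cond_prob_Un:
  assumes "C \<in> sets M" "D \<in> sets M" "C \<inter> D = {}"
  shows "AE x in M. cond_prob (C \<union> D) x = cond_prob C x + cond_prob D x"
proof -
  have "(indicator (C \<union> D) :: 'a \<Rightarrow> real) = (\<lambda>x. indicator C x + indicator D x)"
    using assms(3) by (auto simp: indicator_def fun_eq_iff)
  then show ?thesis
    using assms by (auto intro!: real_cond_exp_add simp: less_top[symmetric])
qed

lemma cond_prob_Int:
  assumes "E \<in> sets F" "D \<in> sets M"
  shows "AE x in M. cond_prob (E \<inter> D) x = indicator E x * cond_prob D x"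
proof -
  have "(indicator (E \<inter> D) :: 'a \<Rightarrow> real) = (\<lambda>x. indicator E x * indicator D x)"
    by (auto simp: indicator_def fun_eq_iff)
  then show ?thesis
    using assms sets_F_imp_sets[of E]
    by (auto intro!: real_cond_exp_mult integrable_indicator_mult simp: less_top[symmetric])
qed

text \<open>Testing on the set where the inequality fails turns the integral bounds back into an
  almost sure one. The integral form is the one that passes to increasing unions of sets
  \<open>D\<close>, as the exhaustion below requires.\<close>

lemma cond_prob_le_iff:
  assumes D: "D \<in> sets M" and \<phi>: "\<phi> \<in> borel_measurable F" "integrable M \<phi>"
  shows "(AE x in M. cond_prob D x \<le> \<phi> x) \<longleftrightarrow>
    (\<forall>E\<in>sets F. measure M (E \<inter> D) \<le> (\<integral>x. indicator E x * \<phi> x \<partial>M))" (is "?L \<longleftrightarrow> ?R")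
proof
  assume ?L
  show ?R
  proof
    fix E assume E: "E \<in> sets F"
    have "(\<integral>x. indicator E x * cond_prob D x \<partial>M) \<le> (\<integral>x. indicator E x * \<phi> x \<partial>M)"
      using \<open>?L\<close> D \<phi> E
      by (intro integral_mono_AE integrable_indicator_mult integrable_cond_prob)
         (auto simp: indicator_def)
    then show "measure M (E \<inter> D) \<le> (\<integral>x. indicator E x * \<phi> x \<partial>M)"
      using D E by (simp add: cond_prob_integral)
  qed
next
  assume R: ?R
  note \<phi>(1)[measurable]
  define E where "E = {x \<in> space F. \<phi> x < cond_prob D x}"
  have E: "E \<in> sets F" unfolding E_def by measurable
  let ?d = "\<lambda>x. indicator E x * cond_prob D x - indicator E x * \<phi> x"
  have int: "integrable M (\<lambda>x. indicator E x * cond_prob D x)" "integrable M (\<lambda>x. indicator E x * \<phi> x)"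
    using D \<phi> E by (auto intro!: integrable_indicator_mult integrable_cond_prob)
  have nn: "AE x in M. 0 \<le> ?d x"
    by (intro AE_I2) (auto simp: E_def indicator_def)
  have "(\<integral>x. ?d x \<partial>M) = measure M (E \<inter> D) - (\<integral>x. indicator E x * \<phi> x \<partial>M)"
    using int D E by (simp add: cond_prob_integral)
  also have "\<dots> \<le> 0" using R E by auto
  finally have "(\<integral>x. ?d x \<partial>M) = 0"
    using integral_nonneg_AE[OF nn] by linarith
  then have "AE x in M. ?d x = 0"
    using int nn by (subst (asm) integral_nonneg_eq_0_iff_AE) auto
  then show ?L
    by (rule AE_mp) (intro AE_I2, auto simp: E_def indicator_def space_F split: if_splits)
qed

section \<open>Subsets of small conditional probability\<close>

text \<open>Where \<open>D0\<close> and \<open>D - D0\<close> both have positive conditional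
  probability, one of them has at most half that of \<open>D\<close>. If this happened almost
  nowhere, \<open>D0\<close> would agree up to a null set with \<open>D \<inter> D'\<close>, where
  \<open>D'\<close> is the set in \<open>F\<close> on which \<open>D0\<close> and \<open>D\<close>
  have equal conditional probability, against the choice of \<open>D0\<close>.\<close>

lemma exists_cond_prob_le_half:
  assumes ne: "nowhere_equivalent M F" and D: "D \<in> sets M" "0 < measure M D"
  shows "\<exists>C\<in>sets M. C \<subseteq> D \<and> 0 < measure M C \<and> (AE x in M. cond_prob C x \<le> cond_prob D x / 2)"
proof -
  obtain D0 where D0: "D0 \<in> sets M" "D0 \<subseteq> D"
    and D0': "\<And>D'. D' \<in> sets F \<Longrightarrow> 0 < measure M ((D0 - (D \<inter> D')) \<union> ((D \<inter> D') - D0))"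
    using ne D unfolding nowhere_equivalent_def by meson
  let ?p = "cond_prob D" and ?q = "cond_prob D0"
  \<comment> \<open>\<open>S1\<close> will keep \<open>D0\<close> and \<open>S2\<close> its
    complement in \<open>D\<close>; the bounds \<open>0 < ?q x\<close> and
    \<open>?q x < ?p x\<close> make the conditional probability of the kept piece positive on both
    sets.\<close>
  define S1 where "S1 = {x \<in> space F. 0 < ?q x \<and> ?q x \<le> ?p x / 2}"
  define S2 where "S2 = {x \<in> space F. ?p x / 2 < ?q x \<and> ?q x < ?p x}"
  define D' where "D' = {x \<in> space F. ?q x = ?p x}"
  have S: "S1 \<in> sets F" "S2 \<in> sets F" "D' \<in> sets F"
    unfolding S1_def S2_def D'_def by measurable
  note S_M = S[THEN sets_F_imp_sets]
  define C where "C = (S1 \<inter> D0) \<union> (S2 \<inter> (D - D0))"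
  have sets: "S1 \<inter> D0 \<in> sets M" "S2 \<inter> (D - D0) \<in> sets M" "C \<in> sets M"
    using S_M D0 D by (auto simp: C_def)
  have pq: "AE x in M. 0 \<le> ?q x \<and> ?q x \<le> ?p x"
    using cond_prob_nonneg[OF D0(1)] cond_prob_mono[OF D0(1) D(1) D0(2)] by eventually_elim auto
  have cC: "AE x in M. cond_prob C x = indicator S1 x * ?q x + indicator S2 x * (?p x - ?q x)"
    using cond_prob_Un[OF sets(1,2)] cond_prob_Int[OF S(1) D0(1)] cond_prob_Int[OF S(2), of "D - D0"]
      cond_prob_Diff[OF D0(1) D(1) D0(2)] D D0
    unfolding C_def by fastforce
  have "AE x in M. cond_prob C x \<le> ?p x / 2"
    using cC pq by eventually_elim (auto simp: S1_def S2_def indicator_def)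
  moreover have "0 < measure M C"
  proof (rule ccontr)
    assume "\<not> 0 < measure M C"
    then have "(\<integral>x. indicator (space F) x * cond_prob C x \<partial>M) = 0"
      using sets by (subst cond_prob_integral)
        (auto simp flip: space_F simp: not_less measure_le_0_iff,
         simp add: space_F Int_absorb1 sets.sets_into_space)
    then have "(\<integral>x. cond_prob C x \<partial>M) = 0"
      by (subst Bochner_Integration.integral_cong[where g="\<lambda>x. indicator (space F) x * cond_prob C x"])
         (auto simp: space_F)
    then have "AE x in M. cond_prob C x = 0"
      using integral_nonneg_eq_0_iff_AE[OF integrable_cond_prob cond_prob_nonneg] sets by auto
    with cC pq have dich: "AE x in M. ?q x = 0 \<or> ?q x = ?p x"
      using AE_space
    proof eventually_elim
      case (elim x)
      then show ?case
        by (cases "0 < ?q x"; cases "?q x \<le> ?p x / 2")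
           (auto simp: S1_def S2_def indicator_def space_F)
    qed
    \<comment> \<open>Outside \<open>D'\<close> the dichotomy leaves \<open>?q x = 0\<close>, so
      \<open>D0\<close> is null there; on \<open>D'\<close> the remainder \<open>D - D0\<close> is
      null. Together these two pieces are the symmetric difference of \<open>D0\<close> and
      \<open>D \<inter> D'\<close>.\<close>
    have "measure M ((space F - D') \<inter> D0) = (\<integral>x. indicator (space F - D') x * ?q x \<partial>M)"
      using S D0 by (subst cond_prob_integral) auto
    also have "\<dots> = 0"
      using dich by (intro integral_eq_zero_AE, eventually_elim) (auto simp: D'_def indicator_def)
    finally have 1: "measure M ((space F - D') \<inter> D0) = 0" .
    have "measure M (D' \<inter> (D - D0)) = (\<integral>x. indicator D' x * cond_prob (D - D0) x \<partial>M)"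
      using S D D0 by (subst cond_prob_integral) auto
    also have "\<dots> = 0"
      using cond_prob_Diff[OF D0(1) D(1) D0(2)]
      by (intro integral_eq_zero_AE, eventually_elim) (auto simp: D'_def indicator_def)
    finally have 2: "measure M (D' \<inter> (D - D0)) = 0" .
    have "(D0 - (D \<inter> D')) \<union> ((D \<inter> D') - D0) = ((space F - D') \<inter> D0) \<union> (D' \<inter> (D - D0))"
      using D0 sets.sets_into_space[OF D0(1)] by (auto simp: space_F)
    also have "measure M \<dots> \<le> 0"
      using 1 2 S_M D D0 measure_Un_le[of "(space F - D') \<inter> D0" M "D' \<inter> (D - D0)"]
      by (auto simp: space_F)
    finally show False using D0'[OF S(3)] by simp
  qed
  moreover have "C \<subseteq> D" using D0 by (auto simp: C_def)
  ultimately show ?thesis using sets by blast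
qed

text \<open>Repeated halving. The bound is proportional to \<open>cond_prob D\<close> rather than a
  constant, so the piece also stays where \<open>D\<close> has conditional mass; this keeps a piece
  added later from violating an upper bound elsewhere.\<close>

lemma exists_cond_prob_small:
  assumes ne: "nowhere_equivalent M F" and D: "D \<in> sets M" "0 < measure M D"
  shows "\<exists>C\<in>sets M. C \<subseteq> D \<and> 0 < measure M C \<and> (AE x in M. cond_prob C x \<le> (1/2)^n * cond_prob D x)"
proof (induction n)
  case 0
  then show ?case using D by (intro bexI[of _ D]) auto
next
  case (Suc n)
  then obtain C where C: "C \<in> sets M" "C \<subseteq> D" "0 < measure M C"
    "AE x in M. cond_prob C x \<le> (1/2)^n * cond_prob D x" by blast
  from exists_cond_prob_le_half[OF ne C(1,3)] obtain C' where C': "C' \<in> sets M" "C' \<subseteq> C"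
    "0 < measure M C'" "AE x in M. cond_prob C' x \<le> cond_prob C x / 2" by blast
  have "AE x in M. cond_prob C' x \<le> (1/2)^Suc n * cond_prob D x"
    using C(4) C'(4) by eventually_elim auto
  then show ?case using C C' by blast
qed

end

section \<open>Exhaustion and prescribed conditional probabilities\<close>

text \<open>A greedy choice in countably many steps: each step realises at least half of the gain in
  measure still possible above the current set, so nothing can be gained above the union.\<close>

lemma (in finite_measure) exists_maximal_measure:
  assumes P: "\<And>C. P C \<Longrightarrow> C \<in> sets M" "P {}"
    and UN: "\<And>C :: nat \<Rightarrow> 'a set. incseq C \<Longrightarrow> (\<And>n. P (C n)) \<Longrightarrow> P (\<Union>n. C n)"
  shows "\<exists>C. P C \<and> (\<forall>C'. P C' \<longrightarrow> C \<subseteq> C' \<longrightarrow> measure M C' = measure M C)"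
proof -
  define s where "s C = (SUP C'\<in>{C'. P C' \<and> C \<subseteq> C'}. measure M C')" for C
  have bdd: "bdd_above (measure M ` {C'. P C' \<and> C \<subseteq> C'})" for C
    by (rule bdd_aboveI[of _ "measure M (space M)"]) (auto intro: bounded_measure)
  have le_s: "measure M C' \<le> s C" if "P C'" "C \<subseteq> C'" for C C'
    unfolding s_def using that bdd by (intro cSUP_upper) auto
  have step: "\<exists>C'. P C' \<and> C \<subseteq> C' \<and> (measure M C + s C) / 2 \<le> measure M C'" if "P C" for C
  proof (cases "measure M C = s C")
    case True
    then show ?thesis using that by (intro exI[of _ C]) auto
  next
    case False
    with le_s[OF that, of C] have "(measure M C + s C) / 2 < s C" by auto
    moreover have "{C'. P C' \<and> C \<subseteq> C'} \<noteq> {}" using that by auto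
    ultimately have "\<exists>C'\<in>{C'. P C' \<and> C \<subseteq> C'}. (measure M C + s C) / 2 < measure M C'"
      using less_cSUP_iff[OF _ bdd] unfolding s_def by blast
    then show ?thesis by (auto intro: less_imp_le)
  qed
  obtain C where C: "\<And>n::nat. P (C n)" "\<And>n. C n \<subseteq> C (Suc n)"
    "\<And>n. (measure M (C n) + s (C n)) / 2 \<le> measure M (C (Suc n))"
    using dependent_nat_choice[of "\<lambda>_. P" "\<lambda>_ C C'. C \<subseteq> C' \<and> (measure M C + s C) / 2 \<le> measure M C'"]
      P(2) step by metis
  have inc: "incseq C" using C(2) by (rule incseq_SucI)
  define L where "L = (\<Union>n. C n)"
  have lim: "(\<lambda>n. measure M (C n)) \<longlonglongrightarrow> measure M L"
    unfolding L_def using inc C(1) P(1) by (intro finite_Lim_measure_incseq) auto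
  have "measure M C' = measure M L" if C': "P C'" "L \<subseteq> C'" for C'
  proof (rule antisym)
    \<comment> \<open>A set above the union lies above every \<open>C n\<close>, so its measure is
      at most \<open>s (C n)\<close>; the halving rule rearranges to this bound on
      \<open>s (C n)\<close>, in which both measures converge to \<open>measure M L\<close>.\<close>
    have "measure M C' \<le> 2 * measure M (C (Suc n)) - measure M (C n)" for n
    proof -
      have "C n \<subseteq> C'" using C'(2) by (auto simp: L_def)
      then show ?thesis using le_s[OF C'(1), of "C n"] C(3)[of n] by simp
    qed
    moreover have "(\<lambda>n. 2 * measure M (C (Suc n)) - measure M (C n)) \<longlonglongrightarrow> 2 * measure M L - measure M L"
      by (intro tendsto_intros lim LIMSEQ_Suc[OF lim])
    ultimately have "measure M C' \<le> 2 * measure M L - measure M L"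
      by (intro LIMSEQ_le_const) auto
    then show "measure M C' \<le> measure M L" by simp
    show "measure M L \<le> measure M C'"
      using C' P(1) by (intro finite_measure_mono) auto
  qed
  moreover have "P L" unfolding L_def using inc C(1) by (rule UN)
  ultimately show ?thesis by blast
qed

context finite_measure_subalgebra
begin

text \<open>A maximal subset with conditional probability at most \<open>\<phi>\<close> attains \<open>\<phi>\<close>: on a set where it
  falls short by \<open>2\<^sup>-\<^sup>n\<close>, a piece of the complement with conditional probability
  at most \<open>2\<^sup>-\<^sup>n\<close> could still be added.\<close>

lemma exists_cond_prob_eq:
  assumes ne: "nowhere_equivalent M F" and D: "D \<in> sets M"
    and \<phi>: "\<phi> \<in> borel_measurable F" "integrable M \<phi>"
    and bnd: "AE x in M. 0 \<le> \<phi> x" "AE x in M. \<phi> x \<le> cond_prob D x"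
  shows "\<exists>C\<in>sets M. C \<subseteq> D \<and> (AE x in M. cond_prob C x = \<phi> x)"
proof -
  note \<phi>(1)[measurable]
  define P where "P C \<longleftrightarrow> C \<in> sets M \<and> C \<subseteq> D \<and> (AE x in M. cond_prob C x \<le> \<phi> x)" for C
  have "\<exists>C. P C \<and> (\<forall>C'. P C' \<longrightarrow> C \<subseteq> C' \<longrightarrow> measure M C' = measure M C)"
  proof (rule exists_maximal_measure)
    show "P {}"
      unfolding P_def cond_prob_le_iff[OF sets.empty_sets \<phi>] using bnd(1)
      by (auto intro!: integral_nonneg_AE simp: indicator_def)
    fix C :: "nat \<Rightarrow> 'a set" assume C: "incseq C" "\<And>n. P (C n)"
    then have sets: "\<And>n. C n \<in> sets M" "(\<Union>n. C n) \<in> sets M" by (auto simp: P_def)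
    have "measure M (E \<inter> (\<Union>n. C n)) \<le> (\<integral>x. indicator E x * \<phi> x \<partial>M)" if E: "E \<in> sets F" for E
    proof (rule LIMSEQ_le_const2)
      show "(\<lambda>n. measure M (E \<inter> C n)) \<longlonglongrightarrow> measure M (E \<inter> (\<Union>n. C n))"
        unfolding Int_UN_distrib using C sets sets_F_imp_sets[OF E]
        by (intro finite_Lim_measure_incseq) (auto simp: incseq_def)
      show "\<exists>N. \<forall>n\<ge>N. measure M (E \<inter> C n) \<le> (\<integral>x. indicator E x * \<phi> x \<partial>M)"
        using C(2) E cond_prob_le_iff[OF sets(1) \<phi>] unfolding P_def by blast
    qed
    then show "P (\<Union>n. C n)"
      unfolding P_def cond_prob_le_iff[OF sets(2) \<phi>] using C(2) sets(2) by (auto simp: P_def)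
  qed (auto simp: P_def)
  then obtain C where C: "C \<in> sets M" "C \<subseteq> D" "AE x in M. cond_prob C x \<le> \<phi> x"
    and max: "\<And>C'. P C' \<Longrightarrow> C \<subseteq> C' \<Longrightarrow> measure M C' = measure M C"
    unfolding P_def by blast
  let ?q = "cond_prob C"
  define S where "S n = {x \<in> space F. (1/2)^n \<le> \<phi> x - ?q x}" for n :: nat
  have S: "S n \<in> sets F" for n unfolding S_def by measurable
  note S_M = S[THEN sets_F_imp_sets]
  have "measure M (S n) = 0" for n
  proof (rule ccontr)
    assume "measure M (S n) \<noteq> 0"
    then have pos: "0 < measure M (S n)" by (simp add: zero_less_measure_iff)
    let ?E = "S n \<inter> (D - C)"
    have E: "?E \<in> sets M" using S_M D C by auto
    have cE: "AE x in M. cond_prob ?E x = indicator (S n) x * (cond_prob D x - ?q x)"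
      using cond_prob_Int[OF S, of "D - C"] cond_prob_Diff[OF C(1) D C(2)] D C
      by fastforce
    \<comment> \<open>On \<open>S n\<close> the remainder \<open>D - C\<close> has conditional
      probability at least \<open>\<phi> x - ?q x\<close>, hence at least \<open>(1/2)^n\<close>. So
      \<open>?E\<close> has positive measure and contains a piece thin enough to be added.\<close>
    have "(1/2)^n * measure M (S n) = (\<integral>x. (1/2)^n * indicator (S n) x \<partial>M)"
      using S_M[of n] by (simp add: Int_absorb1 sets.sets_into_space)
    also have "\<dots> \<le> (\<integral>x. indicator (S n) x * (cond_prob D x - ?q x) \<partial>M)"
    proof (rule integral_mono_AE)
      show "integrable M (\<lambda>x. (1/2)^n * indicator (S n) x :: real)"
        using S_M[of n] by (intro integrable_mult_right integrable_real_indicator) (auto simp: emeasure_eq_measure)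
      show "integrable M (\<lambda>x. indicator (S n) x * (cond_prob D x - ?q x))"
        using S[of n] D C
        by (intro integrable_indicator_mult Bochner_Integration.integrable_diff integrable_cond_prob)
      show "AE x in M. (1/2)^n * indicator (S n) x \<le> indicator (S n) x * (cond_prob D x - ?q x)"
        using bnd(2) by eventually_elim (auto simp: indicator_def S_def)
    qed
    also have "\<dots> = measure M ?E"
    proof -
      have "(\<integral>x. indicator (S n) x * (cond_prob D x - ?q x) \<partial>M)
          = measure M (S n \<inter> D) - measure M (S n \<inter> C)"
        using S[of n] D C integrable_cond_prob[OF D] integrable_cond_prob[OF C(1)]
        by (simp add: right_diff_distrib integrable_indicator_mult cond_prob_integral)
      also have "\<dots> = measure M (S n \<inter> D - S n \<inter> C)"
        using S_M[of n] D C by (intro finite_measure_Diff[symmetric]) auto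
      also have "S n \<inter> D - S n \<inter> C = ?E" by auto
      finally show ?thesis .
    qed
    finally have "0 < measure M ?E"
      using pos by (smt (verit) divide_pos_pos mult_pos_pos zero_less_power)
    from exists_cond_prob_small[OF ne E this, of n] obtain B where B: "B \<in> sets M" "B \<subseteq> ?E"
      "0 < measure M B" "AE x in M. cond_prob B x \<le> (1/2)^n * cond_prob ?E x" by blast
    have disj: "C \<inter> B = {}" using B by auto
    have "AE x in M. cond_prob (C \<union> B) x \<le> \<phi> x"
      using cond_prob_Un[OF C(1) B(1) disj] B(4) cE cond_prob_le_1[OF D] cond_prob_nonneg[OF C(1)] C(3)
    proof eventually_elim
      case (elim x)
      show ?case
      proof (cases "x \<in> S n")
        case True
        have "(1/2)^n * (cond_prob D x - ?q x) \<le> (1/2)^n * 1"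
          using elim by (intro mult_left_mono) auto
        moreover have "(1/2)^n \<le> \<phi> x - ?q x" using True by (simp add: S_def)
        moreover have "cond_prob B x \<le> (1/2)^n * (cond_prob D x - ?q x)" using True elim by simp
        ultimately show ?thesis using elim(1) by linarith
      next
        case False
        then show ?thesis using elim by auto
      qed
    qed
    then have "P (C \<union> B)" unfolding P_def using B C by auto
    from max[OF this] have "measure M (C \<union> B) = measure M C" by auto
    moreover have "measure M (C \<union> B) = measure M C + measure M B"
      using B C disj by (intro finite_measure_Union) auto
    ultimately show False using B(3) by simp
  qed
  then have "AE x in M. x \<notin> S n" for n
    using S_M[of n] by (intro AE_not_in null_setsI) (auto simp: emeasure_eq_measure)
  then have "AE x in M. \<forall>n. x \<notin> S n"
    by (simp add: AE_all_countable)
  with C(3) have "AE x in M. ?q x = \<phi> x"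
    using AE_space
  proof eventually_elim
    case (elim x)
    show ?case
    proof (rule ccontr)
      assume "?q x \<noteq> \<phi> x"
      with elim have "0 < \<phi> x - ?q x" by auto
      then obtain n where "(1/2)^n < \<phi> x - ?q x"
        using real_arch_pow_inv[of "\<phi> x - ?q x" "1/2"] by auto
      then show False using elim by (auto simp: S_def space_F dest!: spec[of _ n])
    qed
  qed
  then show ?thesis using C by blast
qed

end

section \<open>Cantor space and its cylinders\<close>

text \<open>Words are read from the right: the head of the list fixes the last coordinate.\<close>

primrec cylinder :: "bool list \<Rightarrow> (nat \<Rightarrow> bool) set" where
  "cylinder [] = UNIV"
| "cylinder (b # w) = {\<omega> \<in> cylinder w. \<omega> (length w) = b}"

text \<open>The product sigma-algebra of infinitely many bits, generated by the nodes of the binary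
  tree so that measurability and equality of measures can be checked node by node.\<close>

definition cantor :: "(nat \<Rightarrow> bool) measure" where
  "cantor = sigma UNIV (range cylinder)"

lemma space_cantor [simp]: "space cantor = UNIV"
  by (simp add: cantor_def)

lemma sets_cantor: "sets cantor = sigma_sets UNIV (range cylinder)"
  by (simp add: cantor_def)

lemma cylinder_in_sets [measurable]: "cylinder w \<in> sets cantor"
  by (auto simp: sets_cantor)

lemma mem_cylinder_iff: "\<omega> \<in> cylinder w \<longleftrightarrow> (\<forall>k<length w. \<omega> k = rev w ! k)"
  by (induction w) (auto simp: nth_append less_Suc_eq)

text \<open>Two cylinders with a common point are nested, the longer word giving the smaller one;
  the empty set is adjoined for the disjoint case.\<close>

lemma Int_stable_cylinders: "Int_stable (insert {} (range cylinder))"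
proof -
  have sub: "cylinder w' \<subseteq> cylinder w"
    if "length w \<le> length w'" "\<omega> \<in> cylinder w" "\<omega> \<in> cylinder w'" for w w' \<omega>
    using that unfolding mem_cylinder_iff subset_iff by (metis order_less_le_trans)
  have "cylinder w \<inter> cylinder w' \<in> insert {} (range cylinder)" for w w'
  proof (cases "cylinder w \<inter> cylinder w' = {}")
    case False
    then obtain \<omega> where \<omega>: "\<omega> \<in> cylinder w" "\<omega> \<in> cylinder w'" by auto
    then have "cylinder w \<inter> cylinder w' = (if length w \<le> length w' then cylinder w' else cylinder w)"
      using sub[of w w' \<omega>] sub[of w' w \<omega>] by auto
    then show ?thesis by auto
  qed simp
  then show ?thesis by (auto simp: Int_stable_def)
qed

text \<open>Such a set is a union of cylinders of words of length \<open>N\<close>. This is the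
  measurability test for the sets of codes that occur in the retraction.\<close>

lemma finitely_determined_in_sets_cantor:
  assumes "\<And>\<omega> \<omega>'. (\<And>k. k < N \<Longrightarrow> \<omega> k = \<omega>' k) \<Longrightarrow> \<omega> \<in> A \<Longrightarrow> \<omega>' \<in> A"
  shows "A \<in> sets cantor"
proof -
  have "A = (\<Union>w\<in>{w. length w = N \<and> cylinder w \<subseteq> A}. cylinder w)"
  proof (intro set_eqI iffI)
    fix \<omega> assume "\<omega> \<in> A"
    let ?w = "rev (map \<omega> [0..<N])"
    have "\<omega>' \<in> A" if "\<omega>' \<in> cylinder ?w" for \<omega>'
      by (rule assms[OF _ \<open>\<omega> \<in> A\<close>]) (use that in \<open>simp add: mem_cylinder_iff\<close>)
    moreover have "\<omega> \<in> cylinder ?w" by (simp add: mem_cylinder_iff)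
    ultimately show "\<omega> \<in> (\<Union>w\<in>{w. length w = N \<and> cylinder w \<subseteq> A}. cylinder w)"
      by (intro UN_I[of ?w]) auto
  qed auto
  also have "\<dots> \<in> sets cantor"
    by (intro sets.countable_UN') auto
  finally show ?thesis .
qed

section \<open>Purification of kernels on Cantor space\<close>

context finite_measure_subalgebra
begin

text \<open>Only the \<open>True\<close> child of a node is chosen: its target lies below that of
  the parent by monotonicity of \<open>K t\<close>, so \<open>exists_cond_prob_eq\<close> applies.
  The \<open>False\<close> child then gets the right conditional probability by subtraction.\<close>

lemma exists_conditional_cylinders:
  assumes ne: "nowhere_equivalent M F" and K: "K \<in> measurable F (prob_algebra cantor)"
  shows "\<exists>D. D [] = space M \<and> (\<forall>w. D w \<in> sets M \<and> D (True # w) \<subseteq> D w \<and>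
    D (False # w) = D w - D (True # w) \<and> (AE t in M. cond_prob (D w) t = measure (K t) (cylinder w)))"
proof -
  have K_meas: "(\<lambda>t. measure (K t) S) \<in> borel_measurable F" if "S \<in> sets cantor" for S
    using measurable_compose[OF K measurable_measure_prob_algebra[OF that]] by simp
  have K_prob: "prob_space (K t)" "sets (K t) = sets cantor" if "t \<in> space M" for t
    using measurable_space[OF K, of t] that by (auto simp: space_F space_prob_algebra)
  have K_int: "integrable M (\<lambda>t. measure (K t) S)" if "S \<in> sets cantor" for S
    using measurable_from_subalg[OF subalg K_meas[OF that]]
    by (intro integrable_const_bound[of _ 1]) (auto intro!: AE_I2 prob_space.prob_le_1 K_prob)
  define good where "good w D \<longleftrightarrow> D \<in> sets M \<and> (AE t in M. cond_prob D t = measure (K t) (cylinder w))" for w D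
  have mono: "measure (K t) (cylinder (True # w)) \<le> measure (K t) (cylinder w)" if "t \<in> space M" for t w
    using K_prob[OF that] by (intro finite_measure.finite_measure_mono) (auto simp: prob_space_def)
  have "\<exists>C. C \<subseteq> D \<and> good (True # w) C" if D: "good w D" for w D
  proof -
    have "AE t in M. measure (K t) (cylinder (True # w)) \<le> cond_prob D t"
    proof -
      have "AE t in M. cond_prob D t = measure (K t) (cylinder w)" using D by (simp add: good_def)
      then show ?thesis using AE_space by eventually_elim (simp add: mono del: cylinder.simps)
    qed
    then show ?thesis
      using exists_cond_prob_eq[OF ne _ K_meas K_int, of D "cylinder (True # w)"] D
      unfolding good_def by (auto simp del: cylinder.simps)
  qed
  then obtain sp where sp: "\<And>w D. good w D \<Longrightarrow> sp w D \<subseteq> D \<and> good (True # w) (sp w D)"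
    by metis
  \<comment> \<open>Each split acts on the set already built at its node, so the tree is a recursion
    on words; the head of a word is the latest split.\<close>
  define D where "D = rec_list (space M) (\<lambda>b w Dw. if b then sp w Dw else Dw - sp w Dw)"
  have D_simps: "D [] = space M" "D (True # w) = sp w (D w)" "D (False # w) = D w - sp w (D w)" for w
    by (simp_all add: D_def)
  have good: "good w (D w)" for w
  proof (induction w)
    case Nil
    have "AE t in M. cond_prob (space M) t = indicator (space M) t"
      using space_F sets.top[of F]
      by (intro real_cond_exp_F_meas) (auto simp: less_top[symmetric] simp del: sets.top)
    then have "AE t in M. cond_prob (space M) t = measure (K t) UNIV"
      using AE_space
    proof eventually_elim
      case (elim t)
      have "space (K t) = UNIV" using sets_eq_imp_space_eq[OF K_prob(2)[OF elim(2)]] by simp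
      then show ?case using elim prob_space.prob_space[OF K_prob(1)[OF elim(2)]] by simp
    qed
    then show ?case by (simp add: good_def D_simps)
  next
    case (Cons b w)
    note s = sp[OF Cons]
    show ?case
    proof (cases b)
      case True
      then show ?thesis using s by (simp add: D_simps)
    next
      case False
      have "AE t in M. cond_prob (D w - sp w (D w)) t = cond_prob (D w) t - cond_prob (sp w (D w)) t"
        using s Cons by (intro cond_prob_Diff) (auto simp: good_def)
      moreover have "AE t in M. cond_prob (D w) t = measure (K t) (cylinder w)"
        "AE t in M. cond_prob (sp w (D w)) t = measure (K t) (cylinder (True # w))"
        using s Cons by (auto simp: good_def)
      ultimately have "AE t in M. cond_prob (D (False # w)) t = measure (K t) (cylinder (False # w))"
        using AE_space
      proof eventually_elim
        case (elim t)
        have "cylinder (False # w) = cylinder w - cylinder (True # w)" by auto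
        moreover have "measure (K t) (cylinder w - cylinder (True # w)) =
            measure (K t) (cylinder w) - measure (K t) (cylinder (True # w))"
          using K_prob[OF elim(4)]
          by (intro finite_measure.finite_measure_Diff) (auto simp: prob_space_def simp del: cylinder.simps, simp)
        ultimately show ?case using elim by (simp add: D_simps del: cylinder.simps)
      qed
      then show ?thesis using s Cons False by (auto simp: good_def D_simps simp del: cylinder.simps)
    qed
  qed
  show ?thesis
    using good sp[OF good] D_simps by (intro exI[of _ D]) (auto simp: good_def)
qed

text \<open>Following the branch of the tree through \<open>t\<close> gives a map whose preimages of
  cylinders are exactly the sets \<open>D w\<close>. For each fixed \<open>E\<close>, agreement on
  cylinders extends to all measurable \<open>S\<close> by the pi-system argument.\<close>

lemma exists_cantor_purification:
  assumes ne: "nowhere_equivalent M F" and K: "K \<in> measurable F (prob_algebra cantor)"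
  shows "\<exists>\<Theta>\<in>measurable M cantor. \<forall>E\<in>sets F. \<forall>S\<in>sets cantor.
    measure M (E \<inter> (\<Theta> -` S \<inter> space M)) = (\<integral>t. indicator E t * measure (K t) S \<partial>M)"
proof -
  obtain D where D0: "D [] = space M" and D: "\<And>w. D w \<in> sets M" "\<And>w. D (True # w) \<subseteq> D w"
    "\<And>w. D (False # w) = D w - D (True # w)"
    and cD: "\<And>w. AE t in M. cond_prob (D w) t = measure (K t) (cylinder w)"
    using exists_conditional_cylinders[OF ne K] by blast
  define Y where "Y w = D (True # w)" for w
  have Y: "Y w \<subseteq> D w" for w using D(2) by (simp add: Y_def)
  \<comment> \<open>Bit \<open>n\<close> records whether the split at depth \<open>n\<close> put
    \<open>t\<close> into the \<open>True\<close> half. Quantifying over all words of length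
    \<open>n\<close> avoids a recursion along the branch; it is unambiguous because the sets of one
    depth are disjoint.\<close>
  define \<Theta> where "\<Theta> t n \<longleftrightarrow> (\<exists>w. length w = n \<and> t \<in> Y w)" for t n
  have D_Cons: "t \<in> D (b # w) \<longleftrightarrow> t \<in> D w \<and> (t \<in> Y w \<longleftrightarrow> b)" for t b w
    using Y[of w] D(3)[of w] by (cases b) (auto simp: Y_def)
  have disj: "w = w'" if "t \<in> D w" "t \<in> D w'" "length w = length w'" for t w w'
    using that(3,1,2) by (induction w w' rule: list_induct2) (auto simp: D_Cons)
  have \<Theta>_iff: "t \<in> D w \<longleftrightarrow> t \<in> space M \<and> \<Theta> t \<in> cylinder w" for t w
  proof (induction w)
    case (Cons b w)
    have "\<Theta> t (length w) \<longleftrightarrow> t \<in> Y w" if "t \<in> D w"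
      using that disj[of t _ w] Y unfolding \<Theta>_def by blast
    with Cons show ?case by (auto simp: D_Cons)
  qed (simp add: D0)
  have \<Theta>[measurable]: "\<Theta> \<in> measurable M cantor"
    unfolding cantor_def
  proof (rule measurable_measure_of)
    fix S assume "S \<in> range cylinder"
    then obtain w where "S = cylinder w" by auto
    then have "\<Theta> -` S \<inter> space M = D w" using \<Theta>_iff by auto
    then show "\<Theta> -` S \<inter> space M \<in> sets M" using D(1) by simp
  qed auto
  have K_prob: "prob_space (K t)" "sets (K t) = sets cantor" if "t \<in> space M" for t
    using measurable_space[OF K, of t] that by (auto simp: space_F space_prob_algebra)
  have K_M: "K \<in> measurable M (prob_algebra cantor)"
    using K subalg by (rule measurable_from_subalg[rotated])
  have K_meas: "(\<lambda>t. measure (K t) S) \<in> borel_measurable M" if "S \<in> sets cantor" for S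
    using measurable_compose[OF K_M measurable_measure_prob_algebra[OF that]] by simp
  have K_int: "integrable M (\<lambda>t. measure (K t) S)" if "S \<in> sets cantor" for S
    using K_meas[OF that]
    by (intro integrable_const_bound[of _ 1]) (auto intro!: AE_I2 prob_space.prob_le_1 K_prob)
  have "measure M (E \<inter> (\<Theta> -` S \<inter> space M)) = (\<integral>t. indicator E t * measure (K t) S \<partial>M)"
    if E: "E \<in> sets F" and S: "S \<in> sets cantor" for E S
  \<comment> \<open>The case distinction serves \<open>bind\<close>, which degenerates over an empty
    space.\<close>
  proof (cases "space M = {}")
    case False
    \<comment> \<open>Weighting \<open>M\<close> by the indicator of \<open>E\<close> turns the two
      sides of the claim into the values at \<open>S\<close> of two finite measures on
      \<open>cantor\<close>: the law of \<open>\<Theta>\<close> and the mixture of the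
      \<open>K t\<close>.\<close>
    let ?N = "density M (indicator E)"
    note E_M[measurable] = sets_F_imp_sets[OF E]
    have K_N: "K \<in> measurable ?N (subprob_algebra cantor)"
      using measurable_prob_algebraD[OF K_M] by simp
    have L: "emeasure (distr ?N cantor \<Theta>) S = measure M (E \<inter> (\<Theta> -` S \<inter> space M))"
      if [measurable]: "S \<in> sets cantor" for S
    proof -
      have "emeasure (distr ?N cantor \<Theta>) S = emeasure ?N (\<Theta> -` S \<inter> space M)"
        by (subst emeasure_distr) auto
      also have "\<dots> = (\<integral>\<^sup>+t. indicator (E \<inter> (\<Theta> -` S \<inter> space M)) t \<partial>M)"
        unfolding indicator_inter_arith[of E] by (rule emeasure_density) measurable
      also have "\<dots> = emeasure M (E \<inter> (\<Theta> -` S \<inter> space M))"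
        by (rule nn_integral_indicator) measurable
      finally show ?thesis by (simp add: emeasure_eq_measure)
    qed
    have R: "emeasure (?N \<bind> K) S = (\<integral>t. indicator E t * measure (K t) S \<partial>M)"
      if [measurable]: "S \<in> sets cantor" for S
    proof -
      have "emeasure (?N \<bind> K) S = (\<integral>\<^sup>+t. emeasure (K t) S \<partial>?N)"
        using False by (intro emeasure_bind[OF _ K_N]) auto
      also have "\<dots> = (\<integral>\<^sup>+t. indicator E t * emeasure (K t) S \<partial>M)"
        using measurable_emeasure_kernel[OF measurable_prob_algebraD[OF K_M] that]
        by (subst nn_integral_density) auto
      also have "\<dots> = (\<integral>\<^sup>+t. ennreal (indicator E t * measure (K t) S) \<partial>M)"
        using K_prob
        by (intro nn_integral_cong)
           (auto simp: indicator_def finite_measure.emeasure_eq_measure prob_space_def)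
      also have "\<dots> = (\<integral>t. indicator E t * measure (K t) S \<partial>M)"
        using K_int that E by (intro nn_integral_eq_integral integrable_indicator_mult) auto
      finally show ?thesis .
    qed
    have eq: "measure M (E \<inter> D w) = (\<integral>t. indicator E t * measure (K t) (cylinder w) \<partial>M)" for w
    proof -
      have "measure M (E \<inter> D w) = (\<integral>t. indicator E t * cond_prob (D w) t \<partial>M)"
        using D(1) E by (rule cond_prob_integral[symmetric])
      also have "\<dots> = (\<integral>t. indicator E t * measure (K t) (cylinder w) \<partial>M)"
        using cD[of w] E_M K_meas[OF cylinder_in_sets, of w] by (intro integral_cong_AE) auto
      finally show ?thesis .
    qed
    have "distr ?N cantor \<Theta> = ?N \<bind> K"
    proof (rule measure_eqI_generator_eq[OF Int_stable_cylinders, of UNIV _ _ "\<lambda>_. UNIV"])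
      fix S assume "S \<in> insert {} (range cylinder)"
      then consider "S = {}" | w where "S = cylinder w" by auto
      then show "emeasure (distr ?N cantor \<Theta>) S = emeasure (?N \<bind> K) S"
      proof cases
        case (2 w)
        have "\<Theta> -` cylinder w \<inter> space M = D w" using \<Theta>_iff by auto
        then show ?thesis using 2 L R eq by simp
      qed simp
    next
      show "range (\<lambda>_::nat. UNIV) \<subseteq> insert {} (range cylinder)"
        using cylinder.simps(1) by blast
      show "emeasure (distr ?N cantor \<Theta>) UNIV \<noteq> \<infinity>"
        using L[of UNIV] sets.top[of cantor] by simp
      have "sets cantor = sigma_sets UNIV (insert {} (range cylinder))"
        unfolding sets_cantor by (rule sigma_sets_eqI) (blast intro: sigma_sets.Basic sigma_sets.Empty)+
      then show sets: "sets (distr ?N cantor \<Theta>) = sigma_sets UNIV (insert {} (range cylinder))"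
        by simp
      show "sets (?N \<bind> K) = sigma_sets UNIV (insert {} (range cylinder))"
        using False sets by (subst sets_bind[of _ _ cantor]) (auto simp: K_prob)
    qed auto
    then show ?thesis
      using L[OF S] R[OF S] by (simp add: integral_nonneg_AE)
  next
    case True
    then have "(\<integral>t. indicator E t * measure (K t) S \<partial>M) = (\<integral>t. 0 \<partial>M)"
      by (intro Bochner_Integration.integral_cong) auto
    then show ?thesis using True by simp
  qed
  then show ?thesis using \<Theta> by blast
qed

end

section \<open>Compact metric spaces as Borel retracts of Cantor space\<close>

text \<open>A point is coded by its memberships in countably many closed balls of arbitrarily small
  radius and decoded as the only common point of the balls marked \<open>True\<close>. The coding
  may jump at the boundary of a ball, but it is Borel, which is what the transport of kernels
  uses.\<close>

lemma compact_cantor_retract: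
  fixes A :: "'b::metric_space set"
  assumes "compact A" "A \<noteq> {}"
  shows "\<exists>\<theta>\<in>measurable (act_space A) cantor. \<exists>r\<in>measurable cantor (act_space A). \<forall>x\<in>A. r (\<theta> x) = x"
proof -
  obtain x0 where x0: "x0 \<in> A" using assms by auto
  have "\<exists>X. finite X \<and> A \<subseteq> (\<Union>x\<in>X. ball x (1 / real (Suc m)))" for m
    using assms(1) by (simp add: compact_eq_totally_bounded)
  then obtain X where X: "\<And>m. finite (X m)"
    "\<And>m. A \<subseteq> (\<Union>x\<in>X m. ball x (1 / real (Suc m)))" by metis
  define P where "P = (\<Union>m. (\<lambda>x. (x, 1 / real (Suc m))) ` X m)"
  have P: "countable P" "P \<noteq> {}"
    using X(1) X(2)[of 0] assms(2) by (auto simp: P_def countable_finite)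
  \<comment> \<open>The nets cover by open balls; their closed versions are taken for the finite
    intersection property used in \<open>H_iff\<close>.\<close>
  define V where "V n = (case from_nat_into P n of (x, e) \<Rightarrow> cball x e)" for n
  define e where "e n = snd (from_nat_into P n)" for n
  have V: "closed (V n)" "\<And>x y. x \<in> V n \<Longrightarrow> y \<in> V n \<Longrightarrow> dist x y \<le> 2 * e n" for n
  proof -
    show "closed (V n)" by (auto simp: V_def split: prod.split)
    show "dist x y \<le> 2 * e n" if "x \<in> V n" "y \<in> V n" for x y
      using that dist_triangle2[of x y "fst (from_nat_into P n)"]
      by (auto simp: V_def e_def dist_commute split: prod.splits)
  qed
  have small: "\<exists>n. x \<in> V n \<and> e n \<le> 1 / real (Suc m)" if x: "x \<in> A" for x m
  proof -
    obtain y where y: "y \<in> X m" "x \<in> ball y (1 / real (Suc m))" using X(2)[of m] x by blast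
    then have "(y, 1 / real (Suc m)) \<in> P" by (auto simp: P_def)
    then obtain n where "from_nat_into P n = (y, 1 / real (Suc m))"
      using from_nat_into_surj[OF P(1)] by metis
    then show ?thesis using y by (intro exI[of _ n]) (auto simp: V_def e_def)
  qed
  define I where "I C \<omega> N = C \<inter> A \<inter> (\<Inter>n\<in>{n. n < N \<and> \<omega> n}. V n)" for C and \<omega> :: "nat \<Rightarrow> bool" and N
  \<comment> \<open>A sequence in \<open>R\<close> marks arbitrarily small balls, so it has at most
    one limit. Bits equal to \<open>False\<close> put no constraint on the limit.\<close>
  define R where "R = {\<omega>. \<forall>m. \<exists>n. \<omega> n \<and> e n \<le> 1 / real (Suc m)}"
  define H where "H C = {\<omega>. \<forall>N. I C \<omega> N \<noteq> {}}" for C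
  define is_lim where "is_lim \<omega> x \<longleftrightarrow> x \<in> A \<and> (\<forall>n. \<omega> n \<longrightarrow> x \<in> V n)" for \<omega> x
  have uniq: "x = y" if lims: "\<omega> \<in> R" "is_lim \<omega> x" "is_lim \<omega> y" for \<omega> x y
  proof (rule ccontr)
    assume "x \<noteq> y"
    \<comment> \<open>The factor 2 is there because a ball of radius \<open>e n\<close> has diameter
      up to \<open>2 * e n\<close>.\<close>
    then obtain m where m: "1 / real (Suc m) < dist x y / 2"
      using reals_Archimedean[of "dist x y / 2"] by (auto simp: inverse_eq_divide)
    obtain n where "\<omega> n" "e n \<le> 1 / real (Suc m)" using lims(1) by (auto simp: R_def)
    with V(2)[of x n y] lims(2,3) m show False by (auto simp: is_lim_def)
  qed
  \<comment> \<open>By compactness, membership in \<open>H C\<close>, a condition on finitely many coordinates at a time,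
    decides whether the limit point lies in \<open>C\<close>; this makes the retraction \<open>r\<close> below measurable.\<close>
  have H_iff: "\<omega> \<in> H C \<longleftrightarrow> (\<exists>x\<in>C. is_lim \<omega> x)" if "closed C" for C \<omega>
  proof
    assume "\<omega> \<in> H C"
    have "(A \<inter> C) \<inter> (\<Inter>n\<in>{n. \<omega> n}. V n) \<noteq> {}"
    proof (rule compact_imp_fip_image)
      show "compact (A \<inter> C)" using assms(1) that by (rule compact_Int_closed)
      fix J assume J: "finite J" "J \<subseteq> {n. \<omega> n}"
      then obtain N where "\<forall>n\<in>J. n < N" using finite_nat_set_iff_bounded by blast
      then have "I C \<omega> N \<subseteq> A \<inter> C \<inter> (\<Inter>n\<in>J. V n)" using J by (auto simp: I_def)
      moreover have "I C \<omega> N \<noteq> {}" using \<open>\<omega> \<in> H C\<close> by (simp add: H_def)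
      ultimately show "A \<inter> C \<inter> (\<Inter>n\<in>J. V n) \<noteq> {}" by blast
    qed (use V(1) in auto)
    then show "\<exists>x\<in>C. is_lim \<omega> x" by (auto simp: is_lim_def)
  qed (auto simp: H_def I_def is_lim_def)
  have R_sets: "R \<in> sets cantor"
  proof -
    have [measurable]: "{\<omega>. \<omega> n} \<in> sets cantor" for n
      by (rule finitely_determined_in_sets_cantor[of "Suc n"]) auto
    have "R = (\<Inter>m. \<Union>n\<in>{n. e n \<le> 1 / real (Suc m)}. {\<omega>. \<omega> n})" by (auto simp: R_def)
    also have "\<dots> \<in> sets cantor"
      by (intro sets.countable_INT' sets.countable_UN') auto
    finally show ?thesis .
  qed
  have H_sets: "H C \<in> sets cantor" for C
  proof -
    have "{\<omega>. I C \<omega> N \<noteq> {}} \<in> sets cantor" for N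
    proof (rule finitely_determined_in_sets_cantor[of N])
      fix \<omega> \<omega>' :: "nat \<Rightarrow> bool" assume "\<And>k. k < N \<Longrightarrow> \<omega> k = \<omega>' k"
      then have "{n. n < N \<and> \<omega> n} = {n. n < N \<and> \<omega>' n}" by auto
      then show "\<omega> \<in> {\<omega>. I C \<omega> N \<noteq> {}} \<Longrightarrow> \<omega>' \<in> {\<omega>. I C \<omega> N \<noteq> {}}" by (simp add: I_def)
    qed
    then have "(\<Inter>N. {\<omega>. I C \<omega> N \<noteq> {}}) \<in> sets cantor"
      by (intro sets.countable_INT') auto
    also have "(\<Inter>N. {\<omega>. I C \<omega> N \<noteq> {}}) = H C" by (auto simp: H_def)
    finally show ?thesis .
  qed
  \<comment> \<open>Sequences that code no point still need a value in \<open>A\<close>; the default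
    \<open>x0\<close> supplies it and causes the case \<open>x0 \<in> C\<close> in
    \<open>r_vimage\<close>.\<close>
  define r where "r \<omega> = (if \<omega> \<in> R \<inter> H UNIV then THE x. is_lim \<omega> x else x0)" for \<omega>
  have r_lim: "is_lim \<omega> (r \<omega>)" if "\<omega> \<in> R" "\<omega> \<in> H UNIV" for \<omega>
    using that uniq[OF that(1)] H_iff[of UNIV \<omega>] unfolding r_def
    by (auto intro!: theI2[of "is_lim \<omega>"])
  have r_A: "r \<omega> \<in> A" for \<omega>
    using r_lim[of \<omega>] x0 by (cases "\<omega> \<in> R \<inter> H UNIV") (auto simp: is_lim_def r_def)
  have r_vimage: "r -` C \<in> sets cantor" if "closed C" for C
  proof -
    have HC: "H C \<subseteq> H UNIV" by (auto simp: H_def I_def)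
    have "r -` C = (R \<inter> H C) \<union> (if x0 \<in> C then UNIV - (R \<inter> H UNIV) else {})"
    proof (intro set_eqI)
      fix \<omega>
      show "\<omega> \<in> r -` C \<longleftrightarrow> \<omega> \<in> (R \<inter> H C) \<union> (if x0 \<in> C then UNIV - (R \<inter> H UNIV) else {})"
      proof (cases "\<omega> \<in> R \<inter> H UNIV")
        case True
        then have "r \<omega> \<in> C \<longleftrightarrow> \<omega> \<in> H C"
          using H_iff[OF that] r_lim uniq by (metis IntE)
        then show ?thesis using True by auto
      next
        case False
        then have "r \<omega> = x0" unfolding r_def by (rule if_not_P)
        then show ?thesis using False HC by auto
      qed
    qed
    then show ?thesis
      using R_sets H_sets sets.compl_sets[of "R \<inter> H UNIV" cantor] by auto
  qed
  have r: "r \<in> measurable cantor (act_space A)"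
    unfolding act_space_def
  proof (intro measurable_restrict_space2 borel_measurableI)
    fix S :: "'b set" assume "open S"
    then have "UNIV - r -` (- S) \<in> sets cantor"
      using r_vimage[of "- S"] sets.compl_sets[of "r -` (- S)" cantor] by auto
    also have "UNIV - r -` (- S) = r -` S \<inter> space cantor" by auto
    finally show "r -` S \<inter> space cantor \<in> sets cantor" .
  qed (use r_A in auto)
  define \<theta> where "\<theta> x n \<longleftrightarrow> x \<in> V n" for x n
  have \<theta>: "\<theta> \<in> measurable (act_space A) cantor"
    unfolding cantor_def
  proof (rule measurable_measure_of)
    fix S assume "S \<in> range cylinder"
    then obtain w where w: "S = cylinder w" by auto
    have "\<theta> -` cylinder w \<inter> A \<in> sets (act_space A)"
    proof (induction w)
      case Nil
      then show ?case
        using sets.top[of "act_space A"] by (simp add: act_space_def space_restrict_space)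
    next
      case (Cons b w)
      have V_A: "V (length w) \<inter> A \<in> sets (act_space A)"
        using V(1) by (auto simp: act_space_def sets_restrict_space)
      have "\<theta> -` cylinder (b # w) \<inter> A =
          (if b then (\<theta> -` cylinder w \<inter> A) \<inter> (V (length w) \<inter> A)
           else (\<theta> -` cylinder w \<inter> A) - (V (length w) \<inter> A))"
        by (auto simp: \<theta>_def)
      then show ?case using Cons V_A by auto
    qed
    then show "\<theta> -` S \<inter> space (act_space A) \<in> sets (act_space A)"
      using w by (simp add: act_space_def space_restrict_space)
  qed auto
  have "r (\<theta> x) = x" if "x \<in> A" for x
  proof -
    have lim: "is_lim (\<theta> x) x" using that by (auto simp: is_lim_def \<theta>_def)
    have "\<theta> x \<in> R" using small[OF that] by (auto simp: R_def \<theta>_def)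
    moreover have "\<theta> x \<in> H UNIV" using H_iff[of UNIV] lim by auto
    ultimately show ?thesis using r_lim uniq lim by blast
  qed
  then show ?thesis using r \<theta> by blast
qed

section \<open>Purification on compact action spaces and supports\<close>

lemma space_act_space [simp]: "space (act_space A) = A"
  by (simp add: act_space_def space_restrict_space)

text \<open>The kernel is pushed to Cantor space along \<open>\<theta>\<close>, purified there, and
  the result is composed with \<open>r\<close>. As \<open>r\<close> undoes \<open>\<theta>\<close>
  on \<open>A\<close>, pulling \<open>B\<close> back along \<open>r\<close> and then along
  \<open>\<theta>\<close> returns \<open>B\<close>.\<close>

lemma (in finite_measure_subalgebra) exists_purification:
  fixes A :: "'b::metric_space set"
  assumes ne: "nowhere_equivalent M F" and A: "compact A"
    and g: "g \<in> measurable F (prob_algebra (act_space A))"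
  shows "\<exists>f\<in>measurable M (act_space A). \<forall>E\<in>sets F. \<forall>B\<in>sets (act_space A).
    (\<integral>t. indicator E t * indicator B (f t) \<partial>M) = (\<integral>t. indicator E t * measure (g t) B \<partial>M)"
proof (cases "space M = {}")
  case True
  then show ?thesis
    by (intro bexI[of _ undefined] ballI Bochner_Integration.integral_cong) (auto simp: measurable_def)
next
  case False
  have g_prob: "prob_space (g t)" "sets (g t) = sets (act_space A)" if "t \<in> space M" for t
    using measurable_space[OF g, of t] that by (auto simp: space_F space_prob_algebra)
  have g_space: "space (g t) = A" if "t \<in> space M" for t
    using sets_eq_imp_space_eq[OF g_prob(2)[OF that]] by simp
  obtain t0 where t0: "t0 \<in> space M" using False by auto
  have "A \<noteq> {}" using prob_space.not_empty[OF g_prob(1)[OF t0]] g_space[OF t0] by simp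
  from compact_cantor_retract[OF A this] obtain \<theta> r where \<theta>: "\<theta> \<in> measurable (act_space A) cantor"
    and r: "r \<in> measurable cantor (act_space A)" and r\<theta>: "\<And>x. x \<in> A \<Longrightarrow> r (\<theta> x) = x"
    by blast
  let ?K = "\<lambda>t. distr (g t) cantor \<theta>"
  have "?K \<in> measurable F (prob_algebra cantor)"
    using measurable_compose[OF g measurable_distr_prob_space[OF \<theta>]] .
  from exists_cantor_purification[OF ne this] obtain \<Theta> where \<Theta>: "\<Theta> \<in> measurable M cantor"
    and \<Theta>_eq: "\<And>E S. E \<in> sets F \<Longrightarrow> S \<in> sets cantor \<Longrightarrow>
      measure M (E \<inter> (\<Theta> -` S \<inter> space M)) = (\<integral>t. indicator E t * measure (?K t) S \<partial>M)"
    by blast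
  have "(\<integral>t. indicator E t * indicator B (r (\<Theta> t)) \<partial>M) = (\<integral>t. indicator E t * measure (g t) B \<partial>M)"
    if E: "E \<in> sets F" and B: "B \<in> sets (act_space A)" for E B
  proof -
    have rB: "r -` B \<in> sets cantor" using measurable_sets[OF r B] by simp
    have "(\<integral>t. indicator E t * indicator B (r (\<Theta> t)) \<partial>M) =
        (\<integral>t. (indicator (E \<inter> (\<Theta> -` (r -` B) \<inter> space M)) t :: real) \<partial>M)"
      by (intro Bochner_Integration.integral_cong) (auto simp: indicator_def)
    also have "\<dots> = measure M (E \<inter> (\<Theta> -` (r -` B) \<inter> space M))"
    proof -
      have T: "E \<inter> (\<Theta> -` (r -` B) \<inter> space M) \<in> sets M"
        using sets_F_imp_sets[OF E] measurable_sets[OF \<Theta> rB] by (rule sets.Int)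
      show ?thesis
        unfolding Bochner_Integration.integral_indicator Int_absorb2[OF sets.sets_into_space[OF T]] ..
    qed
    also have "\<dots> = (\<integral>t. indicator E t * measure (?K t) (r -` B) \<partial>M)"
      using E rB by (rule \<Theta>_eq)
    also have "\<dots> = (\<integral>t. indicator E t * measure (g t) B \<partial>M)"
    proof (intro Bochner_Integration.integral_cong refl)
      fix t assume t: "t \<in> space M"
      have "\<theta> \<in> measurable (g t) cantor"
        using \<theta> measurable_cong_sets[OF g_prob(2)[OF t] refl] by blast
      then have "measure (?K t) (r -` B) = measure (g t) (\<theta> -` (r -` B) \<inter> A)"
        using rB g_space[OF t] by (simp add: measure_distr)
      also have "\<theta> -` (r -` B) \<inter> A = B"
        using r\<theta> sets.sets_into_space[OF B] by auto
      finally show "indicator E t * measure (?K t) (r -` B) = indicator E t * measure (g t) B"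
        by simp
    qed
    finally show ?thesis .
  qed
  then show ?thesis
    using measurable_compose[OF \<Theta> r] by (intro bexI[of _ "\<lambda>t. r (\<Theta> t)"]) auto
qed

text \<open>The ambient type need not be second countable, so the base is built from balls around
  finite nets of \<open>A\<close>; it consists of open sets of the ambient type but is a base only
  at points of \<open>A\<close>.\<close>

lemma compact_countable_base:
  fixes A :: "'b::metric_space set"
  assumes "compact A"
  shows "\<exists>\<B>. countable \<B> \<and> (\<forall>V\<in>\<B>. open V) \<and>
    (\<forall>U x. open U \<longrightarrow> x \<in> U \<inter> A \<longrightarrow> (\<exists>V\<in>\<B>. x \<in> V \<and> V \<subseteq> U))"
proof -
  have "\<exists>X. finite X \<and> A \<subseteq> (\<Union>x\<in>X. ball x (1 / real (Suc m)))" for m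
    using assms by (simp add: compact_eq_totally_bounded)
  then obtain X where X: "\<And>m. finite (X m)" "\<And>m. A \<subseteq> (\<Union>x\<in>X m. ball x (1 / real (Suc m)))"
    by metis
  define \<B> where "\<B> = (\<Union>m. (\<lambda>x. ball x (1 / real (Suc m))) ` X m)"
  have "\<exists>V\<in>\<B>. x \<in> V \<and> V \<subseteq> U" if U: "open U" "x \<in> U \<inter> A" for U x
  proof -
    obtain e where e: "0 < e" "ball x e \<subseteq> U" using U open_contains_ball by blast
    \<comment> \<open>A ball of radius below \<open>e / 2\<close> that contains \<open>x\<close>
      stays within distance \<open>e\<close> of \<open>x\<close>.\<close>
    obtain m where m: "1 / real (Suc m) < e / 2"
      using reals_Archimedean[of "e / 2"] e(1) by (auto simp: inverse_eq_divide)
    obtain y where y: "y \<in> X m" "x \<in> ball y (1 / real (Suc m))" using X(2)[of m] U(2) by blast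
    have "ball y (1 / real (Suc m)) \<subseteq> ball x e"
    proof
      fix z assume "z \<in> ball y (1 / real (Suc m))"
      then show "z \<in> ball x e"
        using y(2) m dist_triangle[of x z y] by (simp add: dist_commute)
    qed
    then show ?thesis using y e by (auto simp: \<B>_def)
  qed
  moreover have "countable \<B>" "\<forall>V\<in>\<B>. open V"
    using X(1) by (auto simp: \<B>_def countable_finite)
  ultimately show ?thesis by blast
qed

text \<open>Conditionally on \<open>{t. g t V = 0}\<close>, a purification almost never takes values in \<open>V\<close>;
  by compactness countably many \<open>V\<close> suffice.\<close>

lemma (in finite_measure_subalgebra) purification_in_supp:
  fixes A :: "'b::metric_space set"
  assumes A: "compact A"
    and g: "g \<in> measurable F (prob_algebra (act_space A))"
    and f: "f \<in> measurable M (act_space A)"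
    and eq: "\<And>E B. E \<in> sets F \<Longrightarrow> B \<in> sets (act_space A) \<Longrightarrow>
    (\<integral>t. indicator E t * indicator B (f t) \<partial>M) = (\<integral>t. indicator E t * measure (g t) B \<partial>M)"
  shows "AE t in M. f t \<in> supp A (g t)"
proof -
  obtain \<B> where \<B>: "countable \<B>" "\<And>V. V \<in> \<B> \<Longrightarrow> open V"
    "\<And>U x. open U \<Longrightarrow> x \<in> U \<inter> A \<Longrightarrow> \<exists>V\<in>\<B>. x \<in> V \<and> V \<subseteq> U"
    using compact_countable_base[OF A] by metis
  have g_prob: "prob_space (g t)" "sets (g t) = sets (act_space A)" if "t \<in> space M" for t
    using measurable_space[OF g, of t] that by (auto simp: space_F space_prob_algebra)
  have "AE t in M. f t \<in> V \<longrightarrow> 0 < measure (g t) (V \<inter> A)" if V: "V \<in> \<B>" for V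
  proof -
    have VA: "V \<inter> A \<in> sets (act_space A)"
      using \<B>(2)[OF V] by (auto simp: act_space_def sets_restrict_space)
    have [measurable]: "(\<lambda>t. measure (g t) (V \<inter> A)) \<in> borel_measurable F"
      using measurable_compose[OF g measurable_measure_prob_algebra[OF VA]] by simp
    define E where "E = {t \<in> space F. measure (g t) (V \<inter> A) = 0}"
    have E: "E \<in> sets F" unfolding E_def by measurable
    have "(\<integral>t. indicator E t * measure (g t) (V \<inter> A) \<partial>M) = 0"
      by (intro integral_eq_zero_AE AE_I2) (auto simp: E_def indicator_def)
    then have 0: "(\<integral>t. indicator E t * indicator (V \<inter> A) (f t) \<partial>M) = (0::real)"
      using eq[OF E VA] by simp
    have "integrable M (\<lambda>t. indicator E t * indicator (V \<inter> A) (f t) :: real)"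
    proof (rule integrable_const_bound[of _ 1])
      have "(\<lambda>t. indicator (V \<inter> A) (f t) :: real) \<in> borel_measurable M"
        using measurable_compose[OF f borel_measurable_indicator[OF VA]] .
      then show "(\<lambda>t. indicator E t * indicator (V \<inter> A) (f t) :: real) \<in> borel_measurable M"
        using sets_F_imp_sets[OF E] by measurable
    qed (auto simp: indicator_def)
    from integral_nonneg_eq_0_iff_AE[OF this] 0
    have "AE t in M. indicator E t * indicator (V \<inter> A) (f t) = (0::real)" by simp
    then show ?thesis
      using AE_space
    proof eventually_elim
      case (elim t)
      have "f t \<in> A" using measurable_space[OF f elim(2)] by simp
      with elim have "f t \<in> V \<Longrightarrow> t \<notin> E" by (auto simp: indicator_def split: if_splits)
      then show ?case using elim(2) by (auto simp: E_def space_F zero_less_measure_iff)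
    qed
  qed
  then have "AE t in M. \<forall>V\<in>\<B>. f t \<in> V \<longrightarrow> 0 < measure (g t) (V \<inter> A)"
    using \<B>(1) by (simp add: AE_ball_countable)
  then show ?thesis
    using AE_space
  proof eventually_elim
    case (elim t)
    have fA: "f t \<in> A" using measurable_space[OF f elim(2)] by simp
    interpret prob_space "g t" using g_prob[OF elim(2)] by simp
    have "0 < measure (g t) (U \<inter> A)" if U: "open U" "f t \<in> U" for U
    proof -
      obtain V where V: "V \<in> \<B>" "f t \<in> V" "V \<subseteq> U" using \<B>(3)[of U "f t"] U fA by blast
      have "0 < measure (g t) (V \<inter> A)" using elim(1) V by blast
      also have "\<dots> \<le> measure (g t) (U \<inter> A)"
        using V(3) g_prob(2)[OF elim(2)] U(1)
        by (intro finite_measure_mono) (auto simp: act_space_def sets_restrict_space)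
      finally show ?thesis .
    qed
    then show ?case using fA by (simp add: supp_def)
  qed
qed

section \<open>Product kernels and the joint law of actions and one type\<close>

lemma kernel_prob_space:
  assumes "f \<in> measurable M (prob_algebra N)" "t \<in> space M"
  shows "prob_space (f t)" "sets (f t) = sets N" "space (f t) = space N"
proof -
  show "prob_space (f t)" and s: "sets (f t) = sets N"
    using measurable_space[OF assms] by (simp_all add: space_prob_algebra)
  show "space (f t) = space N" by (rule sets_eq_imp_space_eq[OF s])
qed

text \<open>Instantiated both with the pure profile, seen as point masses, and with the mixed
  profile, so that joint laws and payoffs are computed once for the two.\<close>

locale kernel_family =
  fixes M :: "'i::finite \<Rightarrow> 't measure" and N :: "'i \<Rightarrow> 'a measure" and f :: "'i \<Rightarrow> 't \<Rightarrow> 'a measure"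
  assumes prob_M: "\<And>i. prob_space (M i)"
    and kernel: "\<And>i. f i \<in> measurable (M i) (prob_algebra (N i))"
begin

abbreviation prod_kernel :: "('i \<Rightarrow> 't) \<Rightarrow> ('i \<Rightarrow> 'a) measure" where
  "prod_kernel t \<equiv> PiM UNIV (\<lambda>j. f j (t j))"

lemma component_space: "t \<in> space (PiM UNIV M) \<Longrightarrow> t j \<in> space (M j)"
  by (auto simp: space_PiM)

lemma prod_kernel_prob_space:
  assumes "t \<in> space (PiM UNIV M)"
  shows "prob_space (prod_kernel t)" "sets (prod_kernel t) = sets (PiM UNIV N)"
    "space (prod_kernel t) = space (PiM UNIV N)"
proof -
  note k = kernel_prob_space[OF kernel component_space[OF assms]]
  show "prob_space (prod_kernel t)" using k(1) by (intro prob_space_PiM)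
  show s: "sets (prod_kernel t) = sets (PiM UNIV N)" using k(2) by (intro sets_PiM_cong) auto
  show "space (prod_kernel t) = space (PiM UNIV N)" using s by (rule sets_eq_imp_space_eq)
qed

lemma emeasure_prod_kernel:
  assumes "t \<in> space (PiM UNIV M)" "\<And>j. X j \<in> sets (N j)"
  shows "emeasure (prod_kernel t) (PiE UNIV X) = (\<Prod>j\<in>UNIV. emeasure (f j (t j)) (X j))"
proof -
  note k = kernel_prob_space[OF kernel component_space[OF assms(1)]]
  interpret product_sigma_finite "\<lambda>j. f j (t j)"
    unfolding product_sigma_finite_def using k(1) prob_space_imp_sigma_finite by blast
  show ?thesis using k(2) assms(2) by (intro emeasure_PiM) auto
qed

text \<open>Boxes are closed under intersection and generate the product, and on a box the kernel is
  a finite product of functions of single coordinates.\<close>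

lemma measurable_prod_kernel: "prod_kernel \<in> measurable (PiM UNIV M) (prob_algebra (PiM UNIV N))"
proof (rule measurable_prob_algebra_generated[OF sets_PiM Int_stable_prod_algebra prod_algebra_sets_into_space])
  fix A assume "A \<in> prod_algebra UNIV N"
  then obtain X where A: "A = PiE UNIV X" and X: "\<And>j. X j \<in> sets (N j)"
    by (auto simp: prod_algebra_eq_finite)
  have "(\<lambda>t. \<Prod>j\<in>UNIV. emeasure (f j (t j)) (X j)) \<in> borel_measurable (PiM UNIV M)"
  proof (rule borel_measurable_prod_ennreal)
    fix j :: 'i
    have "(\<lambda>s. emeasure (f j s) (X j)) \<in> borel_measurable (M j)"
      using measurable_emeasure_kernel[OF measurable_prob_algebraD[OF kernel] X] .
    then show "(\<lambda>t. emeasure (f j (t j)) (X j)) \<in> borel_measurable (PiM UNIV M)"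
      by (rule measurable_compose[OF measurable_component_singleton, rotated]) simp
  qed
  then show "(\<lambda>t. emeasure (prod_kernel t) A) \<in> borel_measurable (PiM UNIV M)"
    unfolding A by (rule measurable_cong[THEN iffD2, rotated]) (simp add: emeasure_prod_kernel X)
qed (auto simp: prod_kernel_prob_space)

lemma integrable_component:
  fixes h :: "'t \<Rightarrow> real"
  assumes "integrable (M i) h"
  shows "integrable (PiM UNIV M) (\<lambda>t. h (t i))"
proof -
  have "distr (PiM UNIV M) (M i) (\<lambda>t. t i) = M i"
    by (intro distr_PiM_component prob_M) simp
  with assms have "integrable (distr (PiM UNIV M) (M i) (\<lambda>t. t i)) h" by simp
  then show ?thesis by (rule integrable_distr[rotated]) simp
qed

text \<open>The law of the action profile together with the type of player \<open>i\<close>. The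
  type is observed only through \<open>F\<close>: distribution equivalence speaks of sets in
  \<open>F\<close>, so laws on the full information space need not agree, while the payoff sees no
  more of the type than \<open>F\<close> does.\<close>

definition joint_law :: "'t measure \<Rightarrow> 'i \<Rightarrow> (('i \<Rightarrow> 'a) \<times> 't) measure" where
  "joint_law F i = PiM UNIV M \<bind>
    (\<lambda>t. distr (prod_kernel t) (PiM UNIV N \<Otimes>\<^sub>M F) (\<lambda>a. (a, t i)))"

lemma measurable_component_subalg:
  assumes "subalgebra (M i) F" shows "(\<lambda>t. t i) \<in> measurable (PiM UNIV M) F"
proof -
  have id: "(\<lambda>s. s) \<in> measurable (M i) F"
    by (rule measurable_from_subalg[OF assms]) simp
  show ?thesis
    by (rule measurable_compose[OF _ id]) (rule measurable_component_singleton, simp)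
qed

lemma joint_kernel:
  assumes "subalgebra (M i) F"
  shows "(\<lambda>t. distr (prod_kernel t) (PiM UNIV N \<Otimes>\<^sub>M F) (\<lambda>a. (a, t i)))
    \<in> measurable (PiM UNIV M) (subprob_algebra (PiM UNIV N \<Otimes>\<^sub>M F))"
proof (rule measurable_distr2[OF _ measurable_prob_algebraD[OF measurable_prod_kernel]])
  have [measurable]: "(\<lambda>t. t i) \<in> measurable (PiM UNIV M) F"
    using assms by (rule measurable_component_subalg)
  show "(\<lambda>(t, a). (a, t i)) \<in> measurable (PiM UNIV M \<Otimes>\<^sub>M PiM UNIV N) (PiM UNIV N \<Otimes>\<^sub>M F)"
    by measurable
qed

lemma space_nonempty: "space (PiM UNIV M) \<noteq> {}"
  by (intro prob_space.not_empty prob_space_PiM prob_M)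

lemma sets_joint_law:
  assumes "subalgebra (M i) F"
  shows "sets (joint_law F i) = sets (PiM UNIV N \<Otimes>\<^sub>M F)"
  unfolding joint_law_def using space_nonempty by (intro sets_bind) auto

lemma nn_integral_joint_law:
  assumes sub: "subalgebra (M i) F" and w: "w \<in> borel_measurable (PiM UNIV N \<Otimes>\<^sub>M F)"
  shows "(\<integral>\<^sup>+x. w x \<partial>joint_law F i) = (\<integral>\<^sup>+t. \<integral>\<^sup>+a. w (a, t i) \<partial>prod_kernel t \<partial>PiM UNIV M)"
  unfolding joint_law_def nn_integral_bind[OF w joint_kernel[OF sub]]
proof (rule nn_integral_cong)
  fix t assume t: "t \<in> space (PiM UNIV M)"
  have "t i \<in> space F" using component_space[OF t, of i] sub by (simp add: subalgebra_def)
  then have "(\<lambda>a. (a, t i)) \<in> measurable (PiM UNIV N) (PiM UNIV N \<Otimes>\<^sub>M F)" by measurable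
  then have "(\<lambda>a. (a, t i)) \<in> measurable (prod_kernel t) (PiM UNIV N \<Otimes>\<^sub>M F)"
    using measurable_cong_sets[OF prod_kernel_prob_space(2)[OF t] refl] by blast
  then show "(\<integral>\<^sup>+x. w x \<partial>distr (prod_kernel t) (PiM UNIV N \<Otimes>\<^sub>M F) (\<lambda>a. (a, t i))) =
      (\<integral>\<^sup>+a. w (a, t i) \<partial>prod_kernel t)"
    using w by (intro nn_integral_distr) auto
qed

text \<open>Independence enters twice: given the types the actions are drawn independently, and the
  types are independent themselves. Each resulting factor is one of the integrals compared by
  distribution equivalence.\<close>

lemma emeasure_joint_law:
  assumes sub: "subalgebra (M i) F" and X: "\<And>j. X j \<in> sets (N j)" and E: "E \<in> sets F"
  shows "emeasure (joint_law F i) (PiE UNIV X \<times> E) =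
    (\<Prod>j\<in>UNIV. (\<integral>t. indicator (if j = i then E else space (M j)) t * measure (f j t) (X j) \<partial>M j))"
proof -
  \<comment> \<open>The condition on the type of player \<open>i\<close> is spread over all players,
    trivially for the others, so that the integrand is a product of functions of one type
    each.\<close>
  let ?E = "\<lambda>j. if j = i then E else space (M j)"
  have E_M: "?E j \<in> sets (M j)" for j using E sub by (auto simp: subalgebra_def)
  interpret product_sigma_finite M
    unfolding product_sigma_finite_def using prob_M prob_space_imp_sigma_finite by blast
  have box: "PiE UNIV X \<in> sets (PiM UNIV N)" using X by (intro sets_PiM_I_finite) auto
  then have "PiE UNIV X \<times> E \<in> sets (PiM UNIV N \<Otimes>\<^sub>M F)" using E by auto
  then have "emeasure (joint_law F i) (PiE UNIV X \<times> E) =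
      (\<integral>\<^sup>+t. \<integral>\<^sup>+a. indicator (PiE UNIV X \<times> E) (a, t i) \<partial>prod_kernel t \<partial>PiM UNIV M)"
    using sets_joint_law[OF sub] nn_integral_joint_law[OF sub, of "indicator (PiE UNIV X \<times> E)"] by simp
  also have "\<dots> = (\<integral>\<^sup>+t. (\<Prod>j\<in>UNIV. indicator (?E j) (t j) * emeasure (f j (t j)) (X j)) \<partial>PiM UNIV M)"
  proof (rule nn_integral_cong)
    fix t assume t: "t \<in> space (PiM UNIV M)"
    have "(\<integral>\<^sup>+a. indicator (PiE UNIV X \<times> E) (a, t i) \<partial>prod_kernel t) =
        (\<integral>\<^sup>+a. indicator E (t i) * indicator (PiE UNIV X) a \<partial>prod_kernel t)"
      by (intro nn_integral_cong) (auto simp: indicator_def)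
    also have "\<dots> = indicator E (t i) * emeasure (prod_kernel t) (PiE UNIV X)"
      using box prod_kernel_prob_space(2)[OF t] by (intro nn_integral_cmult_indicator) simp
    also have "indicator E (t i) = (\<Prod>j\<in>UNIV. indicator (?E j) (t j) :: ennreal)"
    proof -
      have "(\<Prod>j\<in>UNIV. indicator (?E j) (t j) :: ennreal) = (\<Prod>j\<in>UNIV. if j = i then indicator E (t i) else 1)"
        using component_space[OF t] by (intro prod.cong) auto
      then show ?thesis by simp
    qed
    finally show "(\<integral>\<^sup>+a. indicator (PiE UNIV X \<times> E) (a, t i) \<partial>prod_kernel t) =
        (\<Prod>j\<in>UNIV. indicator (?E j) (t j) * emeasure (f j (t j)) (X j))"
      by (simp only: prod.distrib emeasure_prod_kernel[OF t X])
  qed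
  also have "\<dots> = (\<Prod>j\<in>UNIV. \<integral>\<^sup>+t. indicator (?E j) t * emeasure (f j t) (X j) \<partial>M j)"
    using measurable_emeasure_kernel[OF measurable_prob_algebraD[OF kernel] X] E_M
    by (intro product_nn_integral_prod borel_measurable_times_ennreal borel_measurable_indicator) auto
  also have "\<dots> = (\<Prod>j\<in>UNIV. ennreal (\<integral>t. indicator (?E j) t * measure (f j t) (X j) \<partial>M j))"
  proof (intro prod.cong refl)
    fix j
    interpret prob_space "M j" by (rule prob_M)
    have "(\<lambda>t. measure (f j t) (X j)) \<in> borel_measurable (M j)"
      using measurable_compose[OF kernel measurable_measure_prob_algebra[OF X]] by simp
    then have int: "integrable (M j) (\<lambda>t. indicator (?E j) t * measure (f j t) (X j))"
      using E_M[of j] kernel_prob_space(1)[OF kernel] prob_space.prob_le_1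
      by (intro integrable_const_bound[of _ 1] AE_I2 borel_measurable_times borel_measurable_indicator)
         (auto simp: indicator_def)
    have "(\<integral>\<^sup>+t. indicator (?E j) t * emeasure (f j t) (X j) \<partial>M j) =
        (\<integral>\<^sup>+t. ennreal (indicator (?E j) t * measure (f j t) (X j)) \<partial>M j)"
      using kernel_prob_space(1)[OF kernel[of j]]
      by (intro nn_integral_cong)
         (simp add: indicator_def finite_measure.emeasure_eq_measure prob_space_def)
    also have "\<dots> = ennreal (\<integral>t. indicator (?E j) t * measure (f j t) (X j) \<partial>M j)"
      using int by (rule nn_integral_eq_integral) simp
    finally show "(\<integral>\<^sup>+t. indicator (?E j) t * emeasure (f j t) (X j) \<partial>M j) = \<dots>" .
  qed
  also have "\<dots> = ennreal (\<Prod>j\<in>UNIV. \<integral>t. indicator (?E j) t * measure (f j t) (X j) \<partial>M j)"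
    by (rule prod_ennreal) (simp add: integral_nonneg_AE)
  finally show ?thesis .
qed

text \<open>Adding the dominating function \<open>h\<close> makes the payoff nonnegative, so that it becomes a Lebesgue
  integral against the joint law, for which no integrability side conditions are needed.\<close>

lemma payoff_joint_law:
  fixes u :: "'i \<Rightarrow> ('i \<Rightarrow> 'a) \<Rightarrow> 't \<Rightarrow> real"
  assumes sub: "subalgebra (M i) F"
    and u: "(\<lambda>(a, t). u i a t) \<in> borel_measurable (PiM UNIV N \<Otimes>\<^sub>M F)"
    and h: "h \<in> borel_measurable F" "integrable (M i) h"
    and dom: "\<And>a t. a \<in> space (PiM UNIV N) \<Longrightarrow> t \<in> space (M i) \<Longrightarrow> \<bar>u i a t\<bar> \<le> h t"
    and E: "E \<in> sets F"
  shows "payoff M u f i E =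
    enn2real (\<integral>\<^sup>+x. indicator E (snd x) * ennreal (u i (fst x) (snd x) + h (snd x)) \<partial>joint_law F i)
      - (\<integral>t. indicator E (t i) * h (t i) \<partial>PiM UNIV M)"
proof -
  note u[measurable] h(1)[measurable] E[measurable]
  have uh[measurable]: "(\<lambda>x. ennreal (u i (fst x) (snd x) + h (snd x))) \<in> borel_measurable (PiM UNIV N \<Otimes>\<^sub>M F)"
    using u by (simp add: case_prod_beta')
  have comp[measurable]: "(\<lambda>t. t i) \<in> measurable (PiM UNIV M) F"
    using sub by (rule measurable_component_subalg)
  define J where "J t = (\<integral>\<^sup>+a. ennreal (u i a (t i) + h (t i)) \<partial>prod_kernel t)" for t
  have J_meas[measurable]: "J \<in> borel_measurable (PiM UNIV M)"
    unfolding J_def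
  proof (rule nn_integral_measurable_subprob_algebra2[OF _ measurable_prob_algebraD[OF measurable_prod_kernel]])
    have "(\<lambda>(t, a). (a, t i)) \<in> measurable (PiM UNIV M \<Otimes>\<^sub>M PiM UNIV N) (PiM UNIV N \<Otimes>\<^sub>M F)"
      by measurable
    from measurable_compose[OF this uh]
    show "(\<lambda>(t, a). ennreal (u i a (t i) + h (t i))) \<in> borel_measurable (PiM UNIV M \<Otimes>\<^sub>M PiM UNIV N)"
      by (simp add: case_prod_beta')
  qed
  \<comment> \<open>These facts license the passage between Bochner and Lebesgue integrals:
    \<open>J t\<close> is finite, so \<open>enn2real\<close> loses nothing, and
    \<open>2 * h (t i)\<close> bounds it because \<open>u\<close> is at most
    \<open>h\<close>.\<close>
  have inner: "(\<integral>a. u i a (t i) \<partial>prod_kernel t) = enn2real (J t) - h (t i)"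
      "J t = ennreal (enn2real (J t))" "enn2real (J t) \<le> 2 * h (t i)" "0 \<le> h (t i)"
    if t: "t \<in> space (PiM UNIV M)" for t
  proof -
    note k = prod_kernel_prob_space[OF t]
    interpret K: prob_space "prod_kernel t" by (rule k(1))
    have ti: "t i \<in> space (M i)" by (rule component_space[OF t])
    have b: "\<bar>u i a (t i)\<bar> \<le> h (t i)" if "a \<in> space (prod_kernel t)" for a
      using dom[OF _ ti] that k(3) by simp
    have tF: "t i \<in> space F" using ti sub by (simp add: subalgebra_def)
    have "(\<lambda>a. (a, t i)) \<in> measurable (PiM UNIV N) (PiM UNIV N \<Otimes>\<^sub>M F)" using tF by measurable
    from measurable_compose[OF this u]
    have "(\<lambda>a. u i a (t i)) \<in> borel_measurable (PiM UNIV N)" by simp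
    then have m: "(\<lambda>a. u i a (t i)) \<in> borel_measurable (prod_kernel t)"
      using measurable_cong_sets[OF k(2) refl] by blast
    have int: "integrable (prod_kernel t) (\<lambda>a. u i a (t i))"
      using b m by (intro K.integrable_const_bound[of _ "h (t i)"] AE_I2) auto
    have nn: "0 \<le> u i a (t i) + h (t i)" if "a \<in> space (prod_kernel t)" for a
      using b[OF that] by linarith
    have J: "J t = ennreal (\<integral>a. u i a (t i) + h (t i) \<partial>prod_kernel t)"
      unfolding J_def using int nn by (intro nn_integral_eq_integral) auto
    have J0: "0 \<le> (\<integral>a. u i a (t i) + h (t i) \<partial>prod_kernel t)"
      using nn by (intro integral_nonneg_AE AE_I2)
    have eq: "(\<integral>a. u i a (t i) + h (t i) \<partial>prod_kernel t) = (\<integral>a. u i a (t i) \<partial>prod_kernel t) + h (t i)"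
      using int by (simp add: K.prob_space)
    show "J t = ennreal (enn2real (J t))" using J J0 by simp
    show "(\<integral>a. u i a (t i) \<partial>prod_kernel t) = enn2real (J t) - h (t i)" using J J0 eq by simp
    have "(\<integral>a. u i a (t i) \<partial>prod_kernel t) \<le> (\<integral>a. h (t i) \<partial>prod_kernel t)"
      using int b by (intro integral_mono) (auto simp: abs_le_iff)
    then show "enn2real (J t) \<le> 2 * h (t i)" using J J0 eq by (simp add: K.prob_space)
    obtain a where "a \<in> space (prod_kernel t)" using K.not_empty by blast
    then show "0 \<le> h (t i)" using b by fastforce
  qed
  have int_h: "integrable (PiM UNIV M) (\<lambda>t. h (t i))" using h(2) by (rule integrable_component)
  have int1: "integrable (PiM UNIV M) (\<lambda>t. indicator E (t i) * enn2real (J t))"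
    using inner(3,4)
    by (intro Bochner_Integration.integrable_bound[OF integrable_mult_right[OF int_h, of 2]] AE_I2)
       (auto simp: indicator_def)
  have int2: "integrable (PiM UNIV M) (\<lambda>t. indicator E (t i) * h (t i))"
    by (intro Bochner_Integration.integrable_bound[OF int_h] AE_I2) (auto simp: indicator_def)
  have "payoff M u f i E = (\<integral>t. indicator E (t i) * enn2real (J t) - indicator E (t i) * h (t i) \<partial>PiM UNIV M)"
    unfolding payoff_def using inner(1)
    by (intro Bochner_Integration.integral_cong) (auto simp: right_diff_distrib)
  also have "\<dots> = (\<integral>t. indicator E (t i) * enn2real (J t) \<partial>PiM UNIV M)
      - (\<integral>t. indicator E (t i) * h (t i) \<partial>PiM UNIV M)"
    using int1 int2 by (rule Bochner_Integration.integral_diff)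
  also have "(\<integral>t. indicator E (t i) * enn2real (J t) \<partial>PiM UNIV M) =
      enn2real (\<integral>\<^sup>+t. ennreal (indicator E (t i) * enn2real (J t)) \<partial>PiM UNIV M)"
    by (intro integral_eq_nn_integral AE_I2) auto
  also have "(\<integral>\<^sup>+t. ennreal (indicator E (t i) * enn2real (J t)) \<partial>PiM UNIV M) =
      (\<integral>\<^sup>+t. \<integral>\<^sup>+a. indicator E (t i) * ennreal (u i a (t i) + h (t i)) \<partial>prod_kernel t \<partial>PiM UNIV M)"
  proof (rule nn_integral_cong)
    fix t assume t: "t \<in> space (PiM UNIV M)"
    show "ennreal (indicator E (t i) * enn2real (J t)) =
        (\<integral>\<^sup>+a. indicator E (t i) * ennreal (u i a (t i) + h (t i)) \<partial>prod_kernel t)"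
    proof (cases "t i \<in> E")
      case True
      then show ?thesis using inner(2)[OF t] by (simp add: J_def)
    qed simp
  qed
  also have "\<dots> = (\<integral>\<^sup>+x. indicator E (snd x) * ennreal (u i (fst x) (snd x) + h (snd x)) \<partial>joint_law F i)"
    by (subst nn_integral_joint_law[OF sub]) auto
  finally show ?thesis .
qed

end

section \<open>Distribution equivalence determines the joint law\<close>

text \<open>Products of a box of actions with a set in \<open>F i\<close> form a generating
  pi-system, and there both laws are products of one-player integrals that agree by
  \<open>eq\<close>.\<close>

lemma joint_law_eqI:
  fixes M :: "'i::finite \<Rightarrow> 't measure" and N :: "'i \<Rightarrow> 'a measure"
  assumes f: "kernel_family M N f" and g: "kernel_family M N g"
    and sub: "\<And>j. subalgebra (M j) (F j)"
    and eq: "\<And>j E B. E \<in> sets (F j) \<Longrightarrow> B \<in> sets (N j) \<Longrightarrow>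
      (\<integral>t. indicator E t * measure (f j t) B \<partial>M j) = (\<integral>t. indicator E t * measure (g j t) B \<partial>M j)"
  shows "kernel_family.joint_law M N f (F i) i = kernel_family.joint_law M N g (F i) i"
proof -
  interpret f: kernel_family M N f by fact
  interpret g: kernel_family M N g by fact
  let ?G = "{a \<times> b | a b. a \<in> prod_algebra UNIV N \<and> b \<in> sets (F i)}"
  let ?\<Omega> = "space (PiM UNIV N) \<times> space (F i)"
  have box: "a \<in> prod_algebra UNIV N \<longleftrightarrow> (\<exists>X. a = PiE UNIV X \<and> (\<forall>j. X j \<in> sets (N j)))" for a
    by (auto simp: prod_algebra_eq_finite)
  have sub_space: "a \<subseteq> space (PiM UNIV N)" if "a \<in> prod_algebra UNIV N" for a
    using that prod_algebra_sets_into_space[of UNIV N] by (auto simp: space_PiM)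
  have top: "space (PiM UNIV N) \<in> prod_algebra UNIV N"
    unfolding box space_PiM by (intro exI[of _ "\<lambda>j. space (N j)"]) simp
  have G_Pow: "?G \<subseteq> Pow ?\<Omega>"
  proof
    fix Z assume "Z \<in> ?G"
    then obtain a b where Z: "Z = a \<times> b" "a \<in> prod_algebra UNIV N" "b \<in> sets (F i)" by blast
    show "Z \<in> Pow ?\<Omega>"
      unfolding Z(1) using sub_space[OF Z(2)] sets.sets_into_space[OF Z(3)] by (intro PowI Sigma_mono)
  qed
  have sets_eq: "sets (PiM UNIV N \<Otimes>\<^sub>M F i) = sigma_sets ?\<Omega> ?G"
  proof -
    have "sets (PiM UNIV N \<Otimes>\<^sub>M F i) = sets (sigma ?\<Omega> ?G)"
    proof (rule sets_pair_eq)
      show "prod_algebra UNIV N \<subseteq> Pow (space (PiM UNIV N))" using sub_space by blast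
      show "sets (PiM UNIV N) = sigma_sets (space (PiM UNIV N)) (prod_algebra UNIV N)"
        by (simp add: sets_PiM space_PiM)
      show "{space (PiM UNIV N)} \<subseteq> prod_algebra UNIV N" using top by simp
      show "sets (F i) \<subseteq> Pow (space (F i))" by (rule sets.space_closed)
      show "sets (F i) = sigma_sets (space (F i)) (sets (F i))" by (rule sets.sigma_sets_eq[symmetric])
      show "{space (F i)} \<subseteq> sets (F i)" by simp
    qed simp_all
    also have "\<dots> = sigma_sets ?\<Omega> ?G"
      using G_Pow by (rule sets_measure_of)
    finally show ?thesis .
  qed
  show ?thesis
  proof (rule measure_eqI_generator_eq[where E="?G" and \<Omega>="?\<Omega>" and A="\<lambda>_. ?\<Omega>"])
    show "Int_stable ?G"
    proof (rule Int_stableI)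
      fix Z Z' assume "Z \<in> ?G" "Z' \<in> ?G"
      then obtain a b a' b' where Z: "Z = a \<times> b" "a \<in> prod_algebra UNIV N" "b \<in> sets (F i)"
        "Z' = a' \<times> b'" "a' \<in> prod_algebra UNIV N" "b' \<in> sets (F i)" by blast
      have "Z \<inter> Z' = (a \<inter> a') \<times> (b \<inter> b')" by (simp add: Z Times_Int_Times)
      moreover have "a \<inter> a' \<in> prod_algebra UNIV N"
        using Int_stable_prod_algebra[of UNIV N] Z by (simp add: Int_stable_def)
      moreover have "b \<inter> b' \<in> sets (F i)" using Z by simp
      ultimately show "Z \<inter> Z' \<in> ?G" by blast
    qed
    show "?G \<subseteq> Pow ?\<Omega>" by (rule G_Pow)
    show "sets (f.joint_law (F i) i) = sigma_sets ?\<Omega> ?G" "sets (g.joint_law (F i) i) = sigma_sets ?\<Omega> ?G"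
      using f.sets_joint_law[OF sub] g.sets_joint_law[OF sub] sets_eq by auto
    show "range (\<lambda>_::nat. ?\<Omega>) \<subseteq> ?G" using top by blast
    show "emeasure (f.joint_law (F i) i) ?\<Omega> \<noteq> \<infinity>"
      unfolding space_PiM by (subst f.emeasure_joint_law[OF sub]) auto
    fix Z assume "Z \<in> ?G"
    then obtain a E where "Z = a \<times> E" "a \<in> prod_algebra UNIV N" and E: "E \<in> sets (F i)" by blast
    then obtain X where Z: "Z = PiE UNIV X \<times> E" and X: "\<And>j. X j \<in> sets (N j)"
      unfolding box by blast
    \<comment> \<open>For players other than \<open>i\<close> the test set is the whole space; its
      membership in \<open>F j\<close> lets \<open>eq\<close> cover these factors as well.\<close>
    have "space (M j) \<in> sets (F j)" for j
      using sub[of j] sets.top[of "F j"] by (simp add: subalgebra_def)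
    then show "emeasure (f.joint_law (F i) i) Z = emeasure (g.joint_law (F i) i) Z"
      unfolding Z f.emeasure_joint_law[OF sub X E] g.emeasure_joint_law[OF sub X E]
      using E X eq by (intro arg_cong[where f=ennreal] prod.cong) auto
  qed auto
qed

section \<open>Assembly of the undistinguishable purification\<close>

theorem theorem2:
  fixes Act :: "'i::finite \<Rightarrow> 'a::metric_space set"
    and M F :: "'i \<Rightarrow> 't measure"
    and u :: "'i \<Rightarrow> ('i \<Rightarrow> 'a) \<Rightarrow> 't \<Rightarrow> real"
    and g :: "'i \<Rightarrow> 't \<Rightarrow> 'a measure"
  assumes compact_Act: "\<And>i. compact (Act i)"
    and prob: "\<And>i. prob_space (M i)"
    and complete: "\<And>i. complete_measure (M i)"
    and sub: "\<And>i. subalgebra (M i) (F i)"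
    \<comment> \<open>Assumption (P')\<close>
    and F_cg: "\<And>i. countably_generated (F i)"
    and u_meas: "\<And>i. (\<lambda>(a, t). u i a t) \<in> borel_measurable (PiM UNIV (\<lambda>j. act_space (Act j)) \<Otimes>\<^sub>M F i)"
    and u_cont: "\<And>i t. t \<in> space (M i) \<Longrightarrow> continuous_on (Pi UNIV Act) (\<lambda>a. u i a t)"
    and u_dom: "\<And>i. \<exists>h. h \<in> borel_measurable (F i) \<and> integrable (M i) h \<and>
                  (\<forall>a\<in>Pi UNIV Act. \<forall>t\<in>space (M i). \<bar>u i a t\<bar> \<le> h t)"
    \<comment> \<open>Assumption (RD)\<close>
    and atomless: "\<And>i. atomless (M i)"
    and nowhere: "\<And>i. nowhere_equivalent (M i) (F i)"
    \<comment> \<open>g is a mixed strategy profile with each g_i F_i-measurable\<close>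
    and g_meas: "\<And>i. g i \<in> measurable (F i) (prob_algebra (act_space (Act i)))"
  shows "\<exists>f :: 'i \<Rightarrow> 't \<Rightarrow> 'a.
           (\<forall>i. f i \<in> measurable (M i) (act_space (Act i))) \<and>
           univ_dist_equiv Act M F (pure_to_mixed Act f) g \<and>
           univ_payoff_equiv M F u (pure_to_mixed Act f) g \<and>
           belief_consistent Act M f g"
proof -
  have fms: "finite_measure_subalgebra (M i) (F i)" for i
    using prob[of i] sub[of i]
    by (simp add: finite_measure_subalgebra_def finite_measure_subalgebra_axioms_def prob_space_def)
  \<comment> \<open>Each player is purified separately, without coordination: under independence
    payoffs depend on the profile only through one-player integrals.\<close>
  have "\<forall>i. \<exists>f. f \<in> measurable (M i) (act_space (Act i)) \<and>
      (\<forall>E\<in>sets (F i). \<forall>B\<in>sets (act_space (Act i)).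
        (\<integral>t. indicator E t * indicator B (f t) \<partial>M i) = (\<integral>t. indicator E t * measure (g i t) B \<partial>M i))"
    using finite_measure_subalgebra.exists_purification[OF fms nowhere compact_Act g_meas]
    unfolding Bex_def by (rule allI)
  from choice[OF this] obtain f where f: "\<And>i. f i \<in> measurable (M i) (act_space (Act i))"
    and f_eq: "\<And>i E B. E \<in> sets (F i) \<Longrightarrow> B \<in> sets (act_space (Act i)) \<Longrightarrow>
      (\<integral>t. indicator E t * indicator B (f i t) \<partial>M i) = (\<integral>t. indicator E t * measure (g i t) B \<partial>M i)"
    by blast
  let ?f = "pure_to_mixed Act f"
  have pure: "?f i = (\<lambda>t. return (act_space (Act i)) (f i t))" for i
    by (simp add: pure_to_mixed_def fun_eq_iff)
  have kf: "kernel_family M (\<lambda>i. act_space (Act i)) ?f"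
    using prob measurable_compose[OF f measurable_return_prob_space]
    by (simp add: kernel_family_def pure)
  have kg: "kernel_family M (\<lambda>i. act_space (Act i)) g"
    using prob measurable_from_subalg[OF sub g_meas] by (simp add: kernel_family_def)
  have dist: "(\<integral>t. indicator E t * measure (?f i t) B \<partial>M i) = (\<integral>t. indicator E t * measure (g i t) B \<partial>M i)"
    if "E \<in> sets (F i)" "B \<in> sets (act_space (Act i))" for i E B
    using f_eq[OF that] that(2) by (simp add: pure measure_return)
  have "payoff M u ?f i E = payoff M u g i E" if E: "E \<in> sets (F i)" for i E
  proof -
    obtain h where h: "h \<in> borel_measurable (F i)" "integrable (M i) h"
      and dom: "\<And>a t. a \<in> Pi UNIV Act \<Longrightarrow> t \<in> space (M i) \<Longrightarrow> \<bar>u i a t\<bar> \<le> h t"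
      using u_dom[of i] by blast
    have dom': "\<And>a t. a \<in> space (PiM UNIV (\<lambda>j. act_space (Act j))) \<Longrightarrow> t \<in> space (M i) \<Longrightarrow> \<bar>u i a t\<bar> \<le> h t"
      using dom by (simp add: space_PiM PiE_UNIV_domain)
    \<comment> \<open>The subtracted integral of \<open>h\<close> does not involve the profile
      \<open>q\<close>, so equal joint laws give equal payoffs.\<close>
    have payoff: "payoff M u q i E =
        enn2real (\<integral>\<^sup>+x. indicator E (snd x) * ennreal (u i (fst x) (snd x) + h (snd x))
          \<partial>kernel_family.joint_law M (\<lambda>j. act_space (Act j)) q (F i) i)
        - (\<integral>t. indicator E (t i) * h (t i) \<partial>PiM UNIV M)"
      if "kernel_family M (\<lambda>j. act_space (Act j)) q" for q
      using that sub u_meas h dom' E by (rule kernel_family.payoff_joint_law)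
    have "kernel_family.joint_law M (\<lambda>j. act_space (Act j)) ?f (F i) i =
        kernel_family.joint_law M (\<lambda>j. act_space (Act j)) g (F i) i"
      using kf kg sub dist by (rule joint_law_eqI)
    then show ?thesis
      by (simp only: payoff[OF kf] payoff[OF kg])
  qed
  moreover have "AE t in M i. f i t \<in> supp (Act i) (g i t)" for i
    using finite_measure_subalgebra.purification_in_supp[OF fms compact_Act g_meas f f_eq] .
  ultimately show ?thesis
    using f dist
    by (intro exI[of _ f]) (simp add: univ_dist_equiv_def univ_payoff_equiv_def belief_consistent_def)
qed

end
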